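(* Let $d \ge 1$. There exist constants $c, C > 0$ depending only on $d$ such that for every Lebesgue measurable set $A \subset \mathbb{R}^d$ and every $t > 0$, one has $$c \sup_{h \in B(0,t)} |(A + h) \triangle A| \;\le\; K(t, A) \;\le\; C \sup_{h \in B(0,t)} |(A + h) \triangle A|.$$
   Context: $|E|$ denotes the Lebesgue measure of a measurable set $E \subset \mathbb{R}^d$, $\chi_E$ its characteristic function, $B(0,t)$ the ball of radius $t$ centered at $0$ in $\mathbb{R}^d$, $A + h := \{x + h : x \in A\}$, and $A \triangle U := (A \setminus U) \cup (U \setminus A)$ the symmetric difference. The perimeter (in the sense of De Giorgi) of a measurable set $E \subset \mathbb{R}^d$ is $\operatorname{Per}(E) := |D\chi_E|(\mathbb{R}^d) = \sup\{ \int_E \operatorname{div}\Phi \, dx : \Phi \in C_c^\infty(\mathbb{R}^d;\mathbb{R}^d),\ |\Phi| \le 1 \} \in [0,\infty]$, and $E$ has finite perimeter if $\operatorname{Per}(E) < \infty$. For a measurable set $A \subset \mathbb{R}^d$ and $t > 0$, the penalty functional is $$K(t, A) := \inf_{U \subset \mathbb{R}^d} |A \triangle U| + t \operatorname{Per}(U),$$ where the infimum is taken over all open sets $U \subset \mathbb{R}^d$ of finite perimeter. All quantities take values in $[0,\infty]$. *)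

theory Defs
  imports "HOL-Analysis.Analysis"
begin

text \<open>k-times continuous differentiability on the whole space, via iterated partial derivatives.
  Full differentiability at every stage is implied by continuity of the partials, so requiring it
  does not change the class; it makes \<^const>\<open>frechet_derivative\<close> meaningful.\<close>

primrec C_k :: "nat \<Rightarrow> (real ^ 'n::finite \<Rightarrow> real ^ 'n) \<Rightarrow> bool" where
  "C_k 0 \<Phi> \<longleftrightarrow> continuous_on UNIV \<Phi>"
| "C_k (Suc k) \<Phi> \<longleftrightarrow> (\<forall>x. \<Phi> differentiable (at x)) \<and>
     (\<forall>i. C_k k (\<lambda>x. frechet_derivative \<Phi> (at x) (axis i 1)))"

definition test_field :: "(real ^ 'n::finite \<Rightarrow> real ^ 'n) \<Rightarrow> bool" where
  "test_field \<Phi> \<longleftrightarrow> (\<forall>k. C_k k \<Phi>) \<and> compact (closure {x. \<Phi> x \<noteq> 0})"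

definition divergence :: "(real ^ 'n::finite \<Rightarrow> real ^ 'n) \<Rightarrow> real ^ 'n \<Rightarrow> real" where
  "divergence \<Phi> x = (\<Sum>i\<in>UNIV. frechet_derivative \<Phi> (at x) (axis i 1) $ i)"

text \<open>The coercion \<^const>\<open>ennreal\<close> sends negative reals to 0. This does not affect the supremum,
  since the zero field is admissible.\<close>

definition perimeter :: "(real ^ 'n::finite) set \<Rightarrow> ennreal" where
  "perimeter E = (SUP \<Phi> \<in> {\<Phi>. test_field \<Phi> \<and> (\<forall>x. norm (\<Phi> x) \<le> 1)}.
     ennreal (LINT x:E|lebesgue. divergence \<Phi> x))"

definition finite_perimeter :: "(real ^ 'n::finite) set \<Rightarrow> bool" where
  "finite_perimeter E \<longleftrightarrow> perimeter E < \<infinity>"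

definition penalty_K :: "real \<Rightarrow> (real ^ 'n::finite) set \<Rightarrow> ennreal" where
  "penalty_K t A = (INF U \<in> {U. open U \<and> finite_perimeter U}.
     emeasure lebesgue (sym_diff A U) + ennreal t * perimeter U)"

end

theory Submission
  imports Defs "HOL-Computational_Algebra.Polynomial"
begin

text \<open>
  The perimeter is comparable to the rate at which a set moves under small translations, and
  both inequalities reduce to this.

  For the lower bound, \<open>|(U + h) - U| \<le> |h| Per(U)\<close> for every Borel set \<open>U\<close>
  (\<open>emeasure_translate_diff_le_perimeter\<close>): test \<open>\<chi>\<^bsub>U+h\<^esub> - \<chi>\<^sub>U\<close> against smooth functions that
  approximate the indicator of the difference, and differentiate along the segment from 0 to
  \<open>h\<close>. The triangle inequality \<open>|(A + h) \<triangle> A| \<le> 2|A \<triangle> U| + |(U + h) \<triangle> U|\<close> then gives the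
  constant \<open>1/2\<close>.

  For the upper bound a competitor \<open>U\<close> has to be found. Let \<open>S\<close> be the supremum on the right and
  let \<open>v x\<close> be the volume of \<open>A\<close> in the ball of radius \<open>t/2\<close> around \<open>x\<close>. Up to normalisation by
  the volume of the ball, \<open>v\<close> differs from \<open>\<chi>\<^sub>A\<close> by at most \<open>S\<close> in \<open>L\<^sup>1\<close>, and translating \<open>v\<close> by
  \<open>s\<close> changes it in \<open>L\<^sup>1\<close> by at most \<open>C s S/t\<close> if \<open>s \<le> t/2\<close>; both are averages of \<open>|(A + y) \<triangle> A|\<close> over
  \<open>|y| < t\<close> (\<open>nn_integral_shift_diff_le\<close>, \<open>window_measure_shift_le\<close>). Every superlevel set of
  \<open>v\<close> at an intermediate level is close to \<open>A\<close>. By the layer cake formula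
  (\<open>nn_integral_level_sets_diff\<close>) the superlevel sets move, on average over the level, no faster
  than \<open>v\<close>. Since the perimeter is at most the lower limit of the difference quotients
  \<open>|(U + s e\<^sub>i) \<triangle> U|/s\<close> summed over \<open>i\<close> (\<open>perimeter_le_liminf_shift_diff\<close>), Fatou's lemma yields
  a level whose superlevel set has perimeter at most \<open>C S/t\<close> (\<open>exists_good_level_set\<close>). This
  averaging over levels takes the place of the coarea formula.
\<close>

section \<open>Smooth bump functions\<close>

text \<open>Scalar counterpart of \<^const>\<open>C_k\<close>. Multiplying a scalar bump by a constant vector
  produces every test field that the lower bound needs.\<close>

primrec smooth_k :: "nat \<Rightarrow> (real ^ 'n::finite \<Rightarrow> real) \<Rightarrow> bool" where
  "smooth_k 0 f \<longleftrightarrow> continuous_on UNIV f"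
| "smooth_k (Suc k) f \<longleftrightarrow> (\<forall>x. f differentiable (at x)) \<and>
     (\<forall>i. smooth_k k (\<lambda>x. frechet_derivative f (at x) (axis i 1)))"

lemma smooth_k_SucI:
  assumes "\<And>x. (f has_derivative f' x) (at x)"
    and "\<And>i. smooth_k k (\<lambda>x. f' x (axis i 1))"
  shows "smooth_k (Suc k) f"
proof -
  have "frechet_derivative f (at x) = f' x" for x
    using frechet_derivative_at[OF assms(1)] by simp
  then show ?thesis
    using assms by (auto simp: differentiable_def)
qed

lemma smooth_k_SucD: "smooth_k (Suc k) f \<Longrightarrow> smooth_k k f"
proof (induction k arbitrary: f)
  case 0
  then show ?case
    by (auto intro!: differentiable_imp_continuous_on simp: differentiable_on_def)
next
  case (Suc k)
  from Suc.prems have "\<And>i. smooth_k (Suc k) (\<lambda>x. frechet_derivative f (at x) (axis i 1))"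
    unfolding smooth_k.simps(2)[of "Suc k" f] by blast
  with Suc.IH have "\<And>i. smooth_k k (\<lambda>x. frechet_derivative f (at x) (axis i 1))"
    by blast
  with Suc.prems show ?case by simp
qed

lemma smooth_k_has_derivative:
  assumes "smooth_k (Suc k) f"
  shows "(f has_derivative frechet_derivative f (at x)) (at x)"
  using assms by (simp add: frechet_derivative_works[symmetric])

lemma smooth_k_const: "smooth_k k (\<lambda>x. c)"
proof (induction k arbitrary: c)
  case (Suc k)
  show ?case
    by (rule smooth_k_SucI[where f' = "\<lambda>x h. 0"]) (auto intro!: Suc)
qed auto

lemma smooth_k_add:
  assumes "smooth_k k f" "smooth_k k g"
  shows "smooth_k k (\<lambda>x. f x + g x)"
  using assms
proof (induction k arbitrary: f g)
  case 0
  then show ?case by (simp add: continuous_on_add)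
next
  case (Suc k)
  show ?case
    by (rule smooth_k_SucI[OF has_derivative_add[OF smooth_k_has_derivative[OF Suc.prems(1)]
          smooth_k_has_derivative[OF Suc.prems(2)]]])
      (use Suc in auto)
qed

lemma smooth_k_mult:
  assumes "smooth_k k f" "smooth_k k g"
  shows "smooth_k k (\<lambda>x. f x * g x)"
  using assms
proof (induction k arbitrary: f g)
  case 0
  then show ?case by (simp add: continuous_on_mult)
next
  case (Suc k)
  have fg: "smooth_k k f" "smooth_k k g"
    by (rule smooth_k_SucD[OF Suc.prems(1)]) (rule smooth_k_SucD[OF Suc.prems(2)])
  have df: "smooth_k k (\<lambda>x. frechet_derivative f (at x) (axis i 1))"
    and dg: "smooth_k k (\<lambda>x. frechet_derivative g (at x) (axis i 1))" for i
    using Suc.prems by simp_all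
  show ?case
    by (rule smooth_k_SucI[OF has_derivative_mult[OF smooth_k_has_derivative[OF Suc.prems(1)]
          smooth_k_has_derivative[OF Suc.prems(2)]]])
      (intro smooth_k_add Suc.IH fg df dg)
qed

lemma smooth_k_one_minus: "smooth_k k f \<Longrightarrow> smooth_k k (\<lambda>x. 1 - f x)"
  using smooth_k_add[OF smooth_k_const[of k 1] smooth_k_mult[OF smooth_k_const[of k "-1"]]]
  by simp

lemma smooth_k_prod:
  assumes "\<And>j. j \<in> J \<Longrightarrow> smooth_k k (f j)"
  shows "smooth_k k (\<lambda>x. \<Prod>j\<in>J. f j x)"
  using assms
  by (induction J rule: infinite_finite_induct) (auto intro: smooth_k_const smooth_k_mult)

lemma smooth_k_power: "smooth_k k f \<Longrightarrow> smooth_k k (\<lambda>x. f x ^ N)"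
  by (induction N) (auto intro: smooth_k_const smooth_k_mult)

lemma smooth_k_translate: "smooth_k k f \<Longrightarrow> smooth_k k (\<lambda>x. f (x + a))"
proof (induction k arbitrary: f)
  case 0
  then show ?case
    by (auto intro!: continuous_on_compose2[of UNIV f] continuous_intros)
next
  case (Suc k)
  show ?case
  proof (rule smooth_k_SucI)
    show "((\<lambda>x. f (x + a)) has_derivative frechet_derivative f (at (x + a))) (at x)" for x
    proof -
      have "((\<lambda>x. x + a) has_derivative (\<lambda>h. h)) (at x)"
        by (auto intro!: derivative_eq_intros)
      from has_derivative_compose[OF this smooth_k_has_derivative[OF Suc.prems]]
      show ?thesis by simp
    qed
    show "smooth_k k (\<lambda>x. frechet_derivative f (at (x + a)) (axis i 1))" for i
      using Suc.IH[of "\<lambda>x. frechet_derivative f (at x) (axis i 1)"] Suc.prems by simp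
  qed
qed

lemma C_k_scaleR_const: "smooth_k k f \<Longrightarrow> C_k k (\<lambda>x. f x *\<^sub>R v)"
proof (induction k arbitrary: f)
  case 0
  then show ?case by (simp add: continuous_on_scaleR)
next
  case (Suc k)
  have d: "((\<lambda>x. f x *\<^sub>R v) has_derivative (\<lambda>h. frechet_derivative f (at x) h *\<^sub>R v)) (at x)" for x
    by (rule has_derivative_scaleR_left[OF smooth_k_has_derivative[OF Suc.prems]])
  have e: "frechet_derivative (\<lambda>x. f x *\<^sub>R v) (at x) = (\<lambda>h. frechet_derivative f (at x) h *\<^sub>R v)" for x
    using frechet_derivative_at[OF d] by simp
  show ?case
    unfolding C_k.simps e using d Suc by (auto simp: differentiable_def)
qed

text \<open>For \<open>p = 1\<close> this is the classical function that vanishes to infinite order at 0. The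
  polynomial factor is carried along because derivatives produce it.\<close>

definition flat :: "real poly \<Rightarrow> real \<Rightarrow> real" where
  "flat p x = (if x \<le> 0 then 0 else poly p (1 / x) * exp (- (1 / x)))"

lemma poly_times_exp_minus_tendsto_0:
  "((\<lambda>y. poly p y * exp (- y)) \<longlongrightarrow> 0) (at_top :: real filter)"
proof -
  have "((\<lambda>y. \<Sum>i\<le>degree p. coeff p i * (y ^ i / exp y)) \<longlongrightarrow> (\<Sum>i\<le>degree p. coeff p i * 0)) (at_top :: real filter)"
    by (intro tendsto_intros tendsto_power_div_exp_0)
  then show ?thesis
    by (simp add: poly_altdef sum_distrib_right exp_minus divide_inverse mult.assoc)
qed

text \<open>The derivative of \<open>p(1/x) exp(-1/x)\<close> is \<open>(1/x)\<^sup>2 (p - p')(1/x) exp(-1/x)\<close>, a function of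
  the same shape, so the family is closed under differentiation and all its members are smooth. At the
  origin the difference quotient from the right is \<open>y p(y) exp(-y)\<close> with \<open>y = 1/x\<close>, which tends
  to 0.\<close>

lemma flat_has_real_derivative:
  "(flat p has_real_derivative flat (monom 1 2 * (p - pderiv p)) x) (at x)"
proof -
  consider "x < 0" | "x = 0" | "x > 0" by linarith
  then show ?thesis
  proof cases
    case 1
    have "((\<lambda>x. 0) has_real_derivative 0) (at x)" by simp
    moreover have "\<forall>\<^sub>F y in nhds x. flat p y = 0"
      using eventually_nhds_in_open[of "{..<0}" x] 1
      by (auto elim!: eventually_mono simp: flat_def)
    ultimately show ?thesis
      using 1 by (subst DERIV_cong_ev[OF refl _ refl, where g = "\<lambda>x. 0"]) (auto simp: flat_def)
  next
    case 2
    have "((\<lambda>h. poly (pCons 0 p) (inverse h) * exp (- inverse h)) \<longlongrightarrow> 0) (at_right 0)"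
      by (rule filterlim_compose[OF poly_times_exp_minus_tendsto_0 filterlim_inverse_at_top_right])
    then have r: "((\<lambda>h. flat p h / h) \<longlongrightarrow> 0) (at_right 0)"
      by (rule Lim_transform_eventually)
        (auto simp: eventually_at_right_field flat_def field_simps intro!: exI[of _ 1])
    have l: "((\<lambda>h. flat p h / h) \<longlongrightarrow> 0) (at_left 0)"
      by (rule Lim_transform_eventually[OF tendsto_const])
        (auto simp: eventually_at_left_field flat_def intro!: exI[of _ "-1"])
    show ?thesis
      using l r 2 by (simp add: DERIV_def filterlim_at_split) (simp add: flat_def)
  next
    case 3
    have "((\<lambda>x. poly p (1 / x) * exp (- (1 / x))) has_real_derivative
        flat (monom 1 2 * (p - pderiv p)) x) (at x)"
      using 3
      by (auto intro!: derivative_eq_intros DERIV_chain2[OF poly_DERIV]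
          simp: flat_def poly_monom field_simps power2_eq_square)
    moreover have "\<forall>\<^sub>F y in nhds x. flat p y = poly p (1 / y) * exp (- (1 / y))"
      using eventually_nhds_in_open[of "{0<..}" x] 3
      by (auto elim!: eventually_mono simp: flat_def)
    ultimately show ?thesis
      by (subst DERIV_cong_ev[OF refl _ refl]) auto
  qed
qed

lemma smooth_k_flat_affine: "smooth_k k (\<lambda>x. flat p (c * x $ i + d))"
proof (induction k arbitrary: p)
  case 0
  have "continuous_on UNIV (flat p)"
    using flat_has_real_derivative DERIV_isCont by (blast intro: continuous_at_imp_continuous_on)
  then show ?case
    by (auto intro!: continuous_on_compose2[of UNIV "flat p"] continuous_intros)
next
  case (Suc k)
  show ?case
  proof (rule smooth_k_SucI)
    fix x
    have "((\<lambda>x. c * x $ i + d) has_derivative (\<lambda>h. c * h $ i)) (at x)"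
      by (auto intro!: derivative_eq_intros bounded_linear.has_derivative[OF bounded_linear_vec_nth])
    from has_derivative_compose[OF this flat_has_real_derivative[unfolded has_field_derivative_def]]
    show "((\<lambda>x. flat p (c * x $ i + d)) has_derivative
      (\<lambda>h. (flat (monom 1 2 * (p - pderiv p)) (c * x $ i + d)) * (c * h $ i))) (at x)" .
  next
    fix j
    show "smooth_k k (\<lambda>x. flat (monom 1 2 * (p - pderiv p)) (c * x $ i + d) * (c * axis j 1 $ i))"
      by (intro smooth_k_mult Suc smooth_k_const)
  qed
qed

text \<open>Inside the box this is the product over \<open>i\<close> of \<open>exp(-1/(x\<^sub>i - a\<^sub>i)) exp(-1/(b\<^sub>i - x\<^sub>i))\<close>, one
  flat factor for each face.\<close>

lemma smooth_box_bump:
  fixes a b :: "real ^ 'n::finite"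
  obtains f where "\<And>k. smooth_k k f" "\<And>x. 0 \<le> f x" "\<And>x. f x \<le> 1" "\<And>x. f x > 0 \<longleftrightarrow> x \<in> box a b"
proof
  define f where "f = (\<lambda>x. \<Prod>i\<in>UNIV. flat 1 (1 * x $ i + (- a $ i)) * flat 1 ((-1) * x $ i + b $ i))"
  have flat: "0 \<le> flat 1 y" "flat 1 y \<le> 1" "flat 1 y > 0 \<longleftrightarrow> y > 0" for y
    by (auto simp: flat_def)
  show "smooth_k k f" for k
    unfolding f_def by (intro smooth_k_prod smooth_k_mult smooth_k_flat_affine)
  show "0 \<le> f x" for x
    unfolding f_def by (intro prod_nonneg) (auto simp: flat)
  show "f x \<le> 1" for x
    unfolding f_def by (intro prod_le_1) (auto simp: flat mult_le_one)
  show "f x > 0 \<longleftrightarrow> x \<in> box a b" for x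
  proof
    assume "x \<in> box a b"
    then show "f x > 0" unfolding f_def by (intro prod_pos) (auto simp: flat mem_box_cart)
  next
    assume p: "f x > 0"
    have "flat 1 (1 * x $ i + (- a $ i)) * flat 1 ((-1) * x $ i + b $ i) \<noteq> 0" for i
      using p unfolding f_def by (metis (no_types, lifting) UNIV_I finite less_irrefl prod_zero)
    then show "x \<in> box a b"
      by (auto simp: mem_box_cart flat_def split: if_splits) (smt (verit))+
  qed
qed

text \<open>Cover \<open>K\<close> by finitely many boxes inside \<open>V\<close> and multiply the functions \<open>1 - F\<^sub>p\<close>, where \<open>F\<^sub>p\<close>
  is the bump of the box \<open>p\<close>. The product \<open>g\<close> is 1 off \<open>V\<close> and, by compactness, at most some
  \<open>q < 1\<close> on \<open>K\<close>. A high power of \<open>g\<close> is then small on \<open>K\<close>, and \<open>1 - g\<^sup>N\<close> is the required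
  function.\<close>

lemma smooth_bump_approximates_compact:
  fixes K V :: "(real ^ 'n::finite) set"
  assumes K: "compact K" and V: "open V" and KV: "K \<subseteq> V" and \<eta>: "\<eta> > 0"
  obtains f where "\<And>k. smooth_k k f" "\<And>x. 0 \<le> f x" "\<And>x. f x \<le> 1"
    "\<And>x. x \<notin> V \<Longrightarrow> f x = 0" "\<And>x. x \<in> K \<Longrightarrow> 1 - \<eta> \<le> f x"
proof -
  define P where "P = {p. box (fst p) (snd p) \<subseteq> V}"
  have cover: "K \<subseteq> (\<Union>p\<in>P. box (fst p) (snd p))"
  proof
    fix x assume "x \<in> K"
    with KV V obtain e where "e > 0" "ball x e \<subseteq> V"
      by (meson open_contains_ball subsetD)
    then obtain a b where "box a b \<subseteq> ball x e" "x \<in> box a b"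
      using rational_boxes[of e x] by blast
    with \<open>ball x e \<subseteq> V\<close> have "(a, b) \<in> P" "x \<in> box (fst (a, b)) (snd (a, b))"
      by (auto simp: P_def)
    then show "x \<in> (\<Union>p\<in>P. box (fst p) (snd p))" by blast
  qed
  obtain J where J: "J \<subseteq> P" "finite J" "K \<subseteq> (\<Union>p\<in>J. box (fst p) (snd p))"
    by (rule compactE_image[OF K _ cover]) (auto intro: open_box)
  have "\<forall>p :: (real ^ 'n) \<times> (real ^ 'n). \<exists>f. (\<forall>k. smooth_k k f) \<and>
      (\<forall>x. 0 \<le> f x \<and> f x \<le> 1 \<and> (f x > 0 \<longleftrightarrow> x \<in> box (fst p) (snd p)))"
  proof
    fix p :: "(real ^ 'n) \<times> (real ^ 'n)"
    show "\<exists>f. (\<forall>k. smooth_k k f) \<and>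
        (\<forall>x. 0 \<le> f x \<and> f x \<le> 1 \<and> (f x > 0 \<longleftrightarrow> x \<in> box (fst p) (snd p)))"
      by (rule smooth_box_bump[of "fst p" "snd p"]) blast
  qed
  then obtain F where "\<forall>p :: (real ^ 'n) \<times> (real ^ 'n). (\<forall>k. smooth_k k (F p)) \<and>
      (\<forall>x. 0 \<le> F p x \<and> F p x \<le> 1 \<and> (F p x > 0 \<longleftrightarrow> x \<in> box (fst p) (snd p)))"
    by (rule choice[THEN exE])
  then have F: "smooth_k k (F p)" "0 \<le> F p x" "F p x \<le> 1"
    "F p x > 0 \<longleftrightarrow> x \<in> box (fst p) (snd p)" for p k x
    by blast+
  define g where "g = (\<lambda>x. \<Prod>p\<in>J. 1 - F p x)"
  have g_smooth: "smooth_k k g" for k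
    unfolding g_def by (intro smooth_k_prod smooth_k_one_minus F)
  have g01: "0 \<le> g x" "g x \<le> 1" for x
    unfolding g_def by (auto intro!: prod_nonneg prod_le_1 simp: F)
  have g_out: "g x = 1" if "x \<notin> V" for x
    unfolding g_def
  proof (rule prod.neutral, rule ballI)
    fix p assume "p \<in> J"
    with that J(1) have "x \<notin> box (fst p) (snd p)" by (auto simp: P_def)
    with F(2,4)[of p x] show "1 - F p x = 1" by linarith
  qed
  have g_in: "g x < 1" if "x \<in> K" for x
  proof -
    from that J(3) obtain p where p: "p \<in> J" "x \<in> box (fst p) (snd p)" by auto
    have "g x = (1 - F p x) * (\<Prod>p\<in>J - {p}. 1 - F p x)"
      unfolding g_def using J(2) p(1) by (rule prod.remove)
    also have "\<dots> \<le> (1 - F p x) * 1"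
      by (intro mult_left_mono prod_le_1) (auto simp: F)
    also have "\<dots> < 1" using F(4)[of p x] p(2) by auto
    finally show ?thesis .
  qed
  obtain q where q: "0 \<le> q" "q < 1" "\<And>x. x \<in> K \<Longrightarrow> g x \<le> q"
  proof (cases "K = {}")
    case False
    have "continuous_on K g"
      using g_smooth[of 0] continuous_on_subset by auto
    then obtain y where "y \<in> K" "\<And>x. x \<in> K \<Longrightarrow> g x \<le> g y"
      using continuous_attains_sup[OF K False] by blast
    with that[of "g y"] g_in g01 show ?thesis by auto
  qed (use that[of 0] in auto)
  obtain N where N: "q ^ N < \<eta>" using real_arch_pow_inv[OF \<eta> q(2)] by auto
  show ?thesis
  proof (rule that[of "\<lambda>x. 1 - g x ^ Suc N"])
    show "smooth_k k (\<lambda>x. 1 - g x ^ Suc N)" for k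
      by (intro smooth_k_one_minus smooth_k_power g_smooth)
    show "1 - g x ^ Suc N \<ge> 0" "1 - g x ^ Suc N \<le> 1" for x
      using g01[of x] power_le_one[of "g x" "Suc N"] by (auto simp del: power_Suc)
    show "1 - g x ^ Suc N = 0" if "x \<notin> V" for x using g_out[OF that] by simp
    show "1 - \<eta> \<le> 1 - g x ^ Suc N" if "x \<in> K" for x
    proof -
      have "g x ^ Suc N \<le> g x ^ N"
        using g01[of x] by (intro power_decreasing) auto
      also have "\<dots> \<le> q ^ N" by (intro power_mono q that g01)
      finally show ?thesis using N by simp
    qed
  qed
qed

section \<open>Translates of a set and its perimeter\<close>

lemma lborel_integral_translate:
  fixes g :: "'a::euclidean_space \<Rightarrow> real"
  assumes [measurable]: "g \<in> borel_measurable borel"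
  shows "(\<integral>x. g (x + c) \<partial>lborel) = (\<integral>x. g x \<partial>lborel)"
proof -
  have "(\<integral>x. g x \<partial>lborel) = (\<integral>x. g x \<partial>(distr lborel borel ((+) c)))"
    by (simp add: lborel_distr_plus)
  also have "\<dots> = (\<integral>x. g (c + x) \<partial>lborel)"
    by (rule integral_distr) auto
  finally show ?thesis by (simp add: add.commute)
qed

lemma lborel_emeasure_translate:
  fixes A :: "'a::euclidean_space set"
  assumes [measurable]: "A \<in> sets borel"
  shows "emeasure lborel {x. x + c \<in> A} = emeasure lborel A"
proof -
  have "emeasure lborel A = emeasure (distr lborel borel ((+) c)) A"
    by (simp add: lborel_distr_plus)
  also have "\<dots> = emeasure lborel ((+) c -` A \<inter> space lborel)"
    by (rule emeasure_distr) auto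
  also have "(+) c -` A \<inter> space lborel = {x. x + c \<in> A}" by (auto simp: add.commute)
  finally show ?thesis by simp
qed

lemma set_integral_shift_eq:
  fixes f :: "'a::euclidean_space \<Rightarrow> real"
  assumes [measurable]: "U \<in> sets borel" and f: "integrable lborel f"
  shows "(LINT x:U|lborel. f (x + h)) - (LINT x:U|lborel. f x)
    = (\<integral>x. indicator {x. x - h \<in> U} x * f x - indicator U x * f x \<partial>lborel)"
proof -
  define Uh where "Uh = {x. x - h \<in> U}"
  have [measurable]: "Uh \<in> sets borel" unfolding Uh_def by measurable
  have [measurable]: "f \<in> borel_measurable borel" using f by simp
  have int: "integrable lborel (\<lambda>x. indicator X x * f x)" if "X \<in> sets borel" for X
    using integrable_mult_indicator[OF _ f, of X] that by simp
  have "(LINT x:U|lborel. f (x + h)) = (\<integral>x. indicator Uh (x + h) * f (x + h) \<partial>lborel)"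
    by (simp add: set_lebesgue_integral_def Uh_def indicator_def)
  also have "\<dots> = (\<integral>x. indicator Uh x * f x \<partial>lborel)"
    by (rule lborel_integral_translate[of "\<lambda>x. indicator Uh x * f x"]) measurable
  finally show ?thesis
    unfolding Uh_def[symmetric] by (simp add: set_lebesgue_integral_def int)
qed

lemma measure_less_if_emeasure_less: "emeasure M A < ennreal e \<Longrightarrow> measure M A < e"
  by (cases "emeasure M A") (auto simp: measure_def ennreal_less_iff)

lemma has_derivative_zero_off_support:
  assumes df: "(f has_derivative f') (at x)"
    and B: "\<And>y. y \<notin> B \<Longrightarrow> f y = 0" and x: "x \<notin> closure B"
  shows "f' = (\<lambda>_. 0)"
proof -
  have "(f has_derivative (\<lambda>_. 0)) (at x)"
  proof (rule has_derivative_transform_within_open[OF has_derivative_const[of 0]])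
    show "open (- closure B)" "x \<in> - closure B" using x by auto
    show "0 = f y" if "y \<in> - closure B" for y
      using that B[of y] closure_subset[of B] by auto
  qed
  with df show ?thesis by (rule has_derivative_unique)
qed

text \<open>Differentiation under the integral sign: the difference quotients are bounded by the maximum of
  the directional derivative, and for parameters in a bounded range they vanish outside one fixed
  ball, so dominated convergence applies. This is the link between the distributional definition
  of the perimeter and translations of the set. It is used in both directions: to bound
  translates by the perimeter and to bound the perimeter by translates.\<close>

lemma DERIV_set_integral_translate:
  fixes f :: "'a::euclidean_space \<Rightarrow> real"
  assumes df: "\<And>x. (f has_derivative f' x) (at x)"
    and cont: "continuous_on UNIV (\<lambda>x. f' x v)"
    and B: "bounded B" "\<And>x. x \<notin> B \<Longrightarrow> f x = 0"
    and U[measurable]: "U \<in> sets borel"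
  shows "((\<lambda>s. LINT x:U|lborel. f (x + s *\<^sub>R v)) has_real_derivative
    (LINT x:U|lborel. f' (x + s *\<^sub>R v) v)) (at s)"
proof -
  have fcont: "continuous_on UNIV f"
    by (intro continuous_at_imp_continuous_on ballI has_derivative_continuous[OF df])
  have line: "((\<lambda>t. f (x + t *\<^sub>R v)) has_real_derivative f' (x + t *\<^sub>R v) v) (at t)" for x t
  proof -
    have "((\<lambda>t. x + t *\<^sub>R v) has_derivative (\<lambda>r. r *\<^sub>R v)) (at t)"
      by (auto intro!: derivative_eq_intros)
    from has_derivative_compose[OF this df]
    have "((\<lambda>t. f (x + t *\<^sub>R v)) has_derivative (\<lambda>r. f' (x + t *\<^sub>R v) (r *\<^sub>R v))) (at t)" .
    moreover have "f' (x + t *\<^sub>R v) (r *\<^sub>R v) = f' (x + t *\<^sub>R v) v * r" for r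
      using linear_scale[OF has_derivative_linear[OF df], of "x + t *\<^sub>R v" r v] by simp
    ultimately show ?thesis unfolding has_field_derivative_def by (simp only:)
  qed
  have f'0: "f' x v = 0" if "x \<notin> closure B" for x
    using has_derivative_zero_off_support[OF df B(2) that] by simp
  have "bounded ((\<lambda>x. f' x v) ` closure B)"
    using B(1) cont by (intro compact_imp_bounded compact_continuous_image)
      (auto intro: continuous_on_subset)
  then obtain L where L: "L \<ge> 0" "\<And>x. x \<in> closure B \<Longrightarrow> \<bar>f' x v\<bar> \<le> L"
    unfolding bounded_pos by (metis imageI less_imp_le real_norm_def)
  have L': "\<bar>f' x v\<bar> \<le> L" for x using L f'0[of x] by (cases "x \<in> closure B") auto
  have lip: "\<bar>f (x + a *\<^sub>R v) - f (x + b *\<^sub>R v)\<bar> \<le> L * \<bar>a - b\<bar>" for x a b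
    using field_differentiable_bound[of UNIV "\<lambda>t. f (x + t *\<^sub>R v)" "\<lambda>t. f' (x + t *\<^sub>R v) v" L a b]
      line L' by simp
  obtain R where R: "\<And>x. x \<in> B \<Longrightarrow> norm x \<le> R" using B(1) unfolding bounded_iff by blast
  have far: "f (x + t *\<^sub>R v) = 0" if "x \<notin> cball 0 (R + M * norm v)" "\<bar>t\<bar> \<le> M" for x t M
  proof (rule B(2), rule notI)
    assume "x + t *\<^sub>R v \<in> B"
    from R[OF this] have "norm x \<le> R + \<bar>t\<bar> * norm v"
      using norm_triangle_ineq4[of "x + t *\<^sub>R v" "t *\<^sub>R v"] by simp
    also have "\<dots> \<le> R + M * norm v" using that(2) by (simp add: mult_right_mono)
    finally show False using that(1) by simp
  qed
  have ctr: "continuous_on S (\<lambda>x. f (x + t *\<^sub>R v))" for t S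
    by (rule continuous_on_compose2[OF fcont]) (auto intro!: continuous_intros)
  have ctr': "continuous_on S (\<lambda>x. f' (x + t *\<^sub>R v) v)" for t S
    by (rule continuous_on_compose2[OF cont]) (auto intro!: continuous_intros)
  have [measurable]: "(\<lambda>x. f (x + t *\<^sub>R v)) \<in> borel_measurable borel" for t
    using ctr by (rule borel_measurable_continuous_onI)
  have [measurable]: "(\<lambda>x. f' (x + t *\<^sub>R v) v) \<in> borel_measurable borel" for t
    using ctr' by (rule borel_measurable_continuous_onI)
  have int: "integrable lborel (\<lambda>x. indicator U x * f (x + t *\<^sub>R v))" for t
  proof -
    define S where "S = cball (0::'a) (R + \<bar>t\<bar> * norm v)"
    have "integrable lborel (\<lambda>x. indicator S x *\<^sub>R f (x + t *\<^sub>R v))"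
      unfolding S_def by (rule borel_integrable_compact) (auto intro: ctr)
    moreover have "(\<lambda>x. indicator S x *\<^sub>R f (x + t *\<^sub>R v)) = (\<lambda>x. f (x + t *\<^sub>R v))"
      using far[of _ "\<bar>t\<bar>" t] by (auto simp: indicator_def S_def fun_eq_iff)
    ultimately have "integrable lborel (\<lambda>x. f (x + t *\<^sub>R v))" by (simp only:)
    from integrable_mult_indicator[OF _ this, of U] show ?thesis by simp
  qed
  show ?thesis
    unfolding has_field_derivative_iff tendsto_at_iff_sequentially
  proof (intro allI impI)
    fix X :: "nat \<Rightarrow> real"
    assume Xs: "\<forall>i. X i \<in> UNIV - {s}" and lim: "X \<longlonglongrightarrow> s"
    obtain M where M: "\<And>i. \<bar>X i\<bar> \<le> M"
      using convergent_imp_Bseq[of X] lim unfolding convergent_def Bseq_def by auto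
    have sM: "\<bar>s\<bar> \<le> M"
      by (rule LIMSEQ_le_const2[OF tendsto_rabs[OF lim]]) (use M in auto)
    define W where "W = cball (0::'a) (R + M * norm v)"
    let ?q = "\<lambda>i x. indicator U x * ((f (x + X i *\<^sub>R v) - f (x + s *\<^sub>R v)) / (X i - s))"
    have "(\<lambda>i. \<integral>x. ?q i x \<partial>lborel) \<longlonglongrightarrow> (\<integral>x. indicator U x * f' (x + s *\<^sub>R v) v \<partial>lborel)"
    proof (rule integral_dominated_convergence[where w = "\<lambda>x. L * indicator W x"])
      show "integrable lborel (\<lambda>x. L * indicator W x)"
        unfolding W_def by (intro integrable_mult_right integrable_real_indicator)
          (use emeasure_bounded_finite[of "cball (0::'a) (R + M * norm v)"] in auto)
      show "AE x in lborel. (\<lambda>i. ?q i x) \<longlonglongrightarrow> indicator U x * f' (x + s *\<^sub>R v) v"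
      proof (rule AE_I2)
        fix x
        have "((\<lambda>y. (f (x + y *\<^sub>R v) - f (x + s *\<^sub>R v)) / (y - s)) \<longlongrightarrow> f' (x + s *\<^sub>R v) v) (at s)"
          using line[of x s] unfolding has_field_derivative_iff .
        then have "(\<lambda>i. (f (x + X i *\<^sub>R v) - f (x + s *\<^sub>R v)) / (X i - s)) \<longlonglongrightarrow> f' (x + s *\<^sub>R v) v"
          using Xs lim unfolding tendsto_at_iff_sequentially comp_def by blast
        then show "(\<lambda>i. ?q i x) \<longlonglongrightarrow> indicator U x * f' (x + s *\<^sub>R v) v"
          by (rule tendsto_mult_left)
      qed
      show "AE x in lborel. norm (?q i x) \<le> L * indicator W x" for i
      proof (rule AE_I2)
        fix x
        have "X i \<noteq> s" using Xs by auto
        show "norm (?q i x) \<le> L * indicator W x"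
        proof (cases "x \<in> W")
          case True
          have "\<bar>f (x + X i *\<^sub>R v) - f (x + s *\<^sub>R v)\<bar> / \<bar>X i - s\<bar> \<le> L"
            using lip[of x "X i" s] \<open>X i \<noteq> s\<close> by (simp add: divide_le_eq)
          then show ?thesis using True L(1) by (simp add: indicator_def)
        next
          case False
          then have "f (x + X i *\<^sub>R v) = 0" "f (x + s *\<^sub>R v) = 0"
            using far M sM unfolding W_def by blast+
          then show ?thesis using L(1) by simp
        qed
      qed
    qed measurable
    moreover have "(\<integral>x. ?q i x \<partial>lborel) =
        ((LINT x:U|lborel. f (x + X i *\<^sub>R v)) - (LINT x:U|lborel. f (x + s *\<^sub>R v))) / (X i - s)" for i
    proof -
      have "(\<integral>x. ?q i x \<partial>lborel) = (\<integral>x. (indicator U x * f (x + X i *\<^sub>R v)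
          - indicator U x * f (x + s *\<^sub>R v)) / (X i - s) \<partial>lborel)"
        by (rule Bochner_Integration.integral_cong) (auto simp: algebra_simps diff_divide_distrib)
      then show ?thesis
        by (simp add: set_lebesgue_integral_def int)
    qed
    ultimately show "((\<lambda>y. ((LINT x:U|lborel. f (x + y *\<^sub>R v)) - (LINT x:U|lborel. f (x + s *\<^sub>R v)))
        / (y - s)) \<circ> X) \<longlonglongrightarrow> (LINT x:U|lborel. f' (x + s *\<^sub>R v) v)"
      unfolding comp_def set_lebesgue_integral_def real_scaleR_def by (simp only:)
  qed
qed

lemma continuous_on_divergence:
  assumes "test_field \<Phi>"
  shows "continuous_on UNIV (divergence \<Phi>)"
proof -
  have "C_k (Suc 0) \<Phi>" using assms by (simp only: test_field_def)
  then have "continuous_on UNIV (\<lambda>x. frechet_derivative \<Phi> (at x) (axis i 1))" for i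
    by simp
  then show ?thesis
    unfolding divergence_def[abs_def] by (intro continuous_intros)
qed

lemma set_integral_lebesgue_eq_lborel:
  fixes f :: "'a::euclidean_space \<Rightarrow> real"
  assumes [measurable]: "U \<in> sets borel" "f \<in> borel_measurable borel"
  shows "(LINT x:U|lebesgue. f x) = (LINT x:U|lborel. f x)"
  unfolding set_lebesgue_integral_def by (rule integral_completion) simp

lemma set_integral_divergence_le_perimeter:
  fixes U :: "(real ^ 'n::finite) set"
  assumes [measurable]: "U \<in> sets borel" and T: "test_field \<Phi>" "\<And>x. norm (\<Phi> x) \<le> 1"
  shows "ennreal (LINT x:U|lborel. divergence \<Phi> x) \<le> perimeter U"
proof -
  have "(LINT x:U|lebesgue. divergence \<Phi> x) = (LINT x:U|lborel. divergence \<Phi> x)"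
    by (intro set_integral_lebesgue_eq_lborel assms borel_measurable_continuous_onI
        continuous_on_divergence T)
  moreover have "ennreal (LINT x:U|lebesgue. divergence \<Phi> x) \<le> perimeter U"
    unfolding perimeter_def using T by (intro SUP_upper) simp
  ultimately show ?thesis by simp
qed

lemma test_field_translated_bump:
  assumes f: "\<And>k. smooth_k k f" and B: "bounded B" "\<And>x. x \<notin> B \<Longrightarrow> f x = 0"
  shows "test_field (\<lambda>x. f (x + a) *\<^sub>R w)"
  unfolding test_field_def
proof (intro conjI allI)
  show "C_k k (\<lambda>x. f (x + a) *\<^sub>R w)" for k
    by (intro C_k_scaleR_const smooth_k_translate f)
  have "{x. f (x + a) *\<^sub>R w \<noteq> 0} \<subseteq> (\<lambda>x. - a + x) ` B"
  proof
    fix x assume "x \<in> {x. f (x + a) *\<^sub>R w \<noteq> 0}"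
    then have "x + a \<in> B" using B(2) by auto
    then show "x \<in> (\<lambda>x. - a + x) ` B" by (intro image_eqI[of _ _ "x + a"]) auto
  qed
  then have "bounded {x. f (x + a) *\<^sub>R w \<noteq> 0}"
    using bounded_translation[OF B(1)] bounded_subset by blast
  then show "compact (closure {x. f (x + a) *\<^sub>R w \<noteq> 0})" by simp
qed

lemma linear_eq_sum_axis:
  fixes f :: "real ^ 'n::finite \<Rightarrow> real"
  assumes "linear f"
  shows "f w = (\<Sum>i\<in>UNIV. w $ i * f (axis i 1))"
proof -
  have "f w = f (\<Sum>i\<in>UNIV. w $ i *\<^sub>R axis i 1)"
    using basis_expansion[of w] by (simp add: scalar_mult_eq_scaleR)
  also have "\<dots> = (\<Sum>i\<in>UNIV. w $ i * f (axis i 1))"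
    using assms by (simp add: linear_sum linear_scale)
  finally show ?thesis .
qed

lemma divergence_translated_scaleR_const:
  assumes f: "\<And>x. (f has_derivative f' x) (at x)"
  shows "divergence (\<lambda>x. f (x + a) *\<^sub>R w) x = f' (x + a) w"
proof -
  have "((\<lambda>x. x + a) has_derivative (\<lambda>h. h)) (at x)"
    by (auto intro!: derivative_eq_intros)
  from has_derivative_scaleR_left[OF has_derivative_compose[OF this f]]
  have "((\<lambda>x. f (x + a) *\<^sub>R w) has_derivative (\<lambda>h. f' (x + a) h *\<^sub>R w)) (at x)" .
  from frechet_derivative_at[OF this, symmetric]
  have "divergence (\<lambda>x. f (x + a) *\<^sub>R w) x = (\<Sum>i\<in>UNIV. w $ i * f' (x + a) (axis i 1))"
    by (simp add: divergence_def mult.commute)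
  then show ?thesis
    by (rule trans[OF _ linear_eq_sum_axis[OF has_derivative_linear[OF f], symmetric]])
qed

text \<open>By the mean value theorem along the segment from 0 to \<open>h\<close>, the difference equals
  \<open>\<integral>\<^sub>U D f(x + z h) h dx\<close> for some \<open>z\<close>. The integrand is \<open>|h|\<close> times the divergence of the field
  \<open>f(x + z h) h/|h|\<close>, which has norm at most 1.\<close>

lemma set_integral_shift_le_perimeter:
  fixes U :: "(real ^ 'n::finite) set"
  assumes U: "U \<in> sets borel" and P: "perimeter U = ennreal P" "P \<ge> 0"
    and f: "\<And>k. smooth_k k f" "\<And>x. \<bar>f x\<bar> \<le> 1" and B: "bounded B" "\<And>x. x \<notin> B \<Longrightarrow> f x = 0"
  shows "(LINT x:U|lborel. f (x + h)) - (LINT x:U|lborel. f x) \<le> norm h * P"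
proof (cases "h = 0")
  case False
  define f' where "f' = (\<lambda>x. frechet_derivative f (at x))"
  have df: "(f has_derivative f' x) (at x)" for x
    unfolding f'_def using f(1)[of "Suc 0"] by (rule smooth_k_has_derivative)
  have f'sum: "f' x h = (\<Sum>i\<in>UNIV. h $ i * f' x (axis i 1))" for x
    by (rule linear_eq_sum_axis[OF has_derivative_linear[OF df]])
  have "continuous_on UNIV (\<lambda>x. f' x (axis i 1))" for i
    using f(1)[of "Suc 0"] by (simp add: f'_def)
  then have cont: "continuous_on UNIV (\<lambda>x. f' x h)"
    unfolding f'sum by (intro continuous_intros)
  note D = DERIV_set_integral_translate[of f f' h B U, OF df cont B U]
  obtain z where z: "(LINT x:U|lborel. f (x + 1 *\<^sub>R h)) - (LINT x:U|lborel. f (x + 0 *\<^sub>R h))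
      = (1 - 0) * (LINT x:U|lborel. f' (x + z *\<^sub>R h) h)"
    using MVT2[of 0 1 "\<lambda>s. LINT x:U|lborel. f (x + s *\<^sub>R h)"
        "\<lambda>s. LINT x:U|lborel. f' (x + s *\<^sub>R h) h"] D by auto
  define w where "w = (1 / norm h) *\<^sub>R h"
  let ?\<Phi> = "\<lambda>x. f (x + z *\<^sub>R h) *\<^sub>R w"
  have "ennreal (LINT x:U|lborel. divergence ?\<Phi> x) \<le> perimeter U"
    using False f(2)
    by (intro set_integral_divergence_le_perimeter U test_field_translated_bump[OF f(1) B])
      (auto simp: w_def)
  moreover have "divergence ?\<Phi> x = (1 / norm h) * f' (x + z *\<^sub>R h) h" for x
    using linear_scale[OF has_derivative_linear[OF df], of "x + z *\<^sub>R h" "1 / norm h" h]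
    unfolding divergence_translated_scaleR_const[OF df] by (simp add: w_def)
  ultimately have "(1 / norm h) * (LINT x:U|lborel. f' (x + z *\<^sub>R h) h) \<le> P"
    using P by simp
  then show ?thesis using z False by (simp add: field_simps)
qed simp

text \<open>The measure of \<open>E = (U + h) - U\<close> is the supremum of \<open>\<integral> (\<chi>\<^bsub>U+h\<^esub> - \<chi>\<^sub>U) f\<close> over smooth \<open>f\<close> with
  \<open>0 \<le> f \<le> 1\<close>: let \<open>f\<close> be close to 1 on a large compact part of \<open>E\<close> and vanish outside a
  slightly larger open set. Moving the translation to \<open>f\<close> makes each of these integrals a
  difference that the previous lemma controls. Cutting \<open>E\<close> with balls keeps the measures finite
  and the supports bounded.\<close>

lemma emeasure_translate_diff_le_perimeter:
  fixes U :: "(real ^ 'n::finite) set"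
  assumes U[measurable]: "U \<in> sets borel"
  shows "emeasure lborel {x. x - h \<in> U \<and> x \<notin> U} \<le> ennreal (norm h) * perimeter U"
proof (cases "h = 0 \<or> perimeter U = \<infinity>")
  case True
  then show ?thesis by (auto simp: ennreal_mult_top)
next
  case False
  then obtain P where P: "perimeter U = ennreal P" "P \<ge> 0"
    by (cases "perimeter U") auto
  define E where "E = {x. x - h \<in> U \<and> x \<notin> U}"
  have [measurable]: "E \<in> sets borel" unfolding E_def by measurable
  define En where "En = (\<lambda>n::nat. E \<inter> ball 0 (real n))"
  have [measurable]: "En n \<in> sets borel" for n unfolding En_def by measurable
  have "emeasure lborel (En n) \<le> ennreal (norm h * P)" for n
  proof -
    have fin: "emeasure lborel (En n) < \<infinity>"
      using le_less_trans[OF emeasure_mono[of "En n" "ball 0 (real n)" lborel]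
          emeasure_lborel_ball_finite[of 0 "real n"]]
      by (simp add: En_def)
    have main: "measure lborel (En n) - 3 * \<epsilon> \<le> norm h * P" if \<epsilon>: "0 < \<epsilon>" for \<epsilon>
    proof -
      have EnL: "En n \<in> sets lebesgue" by simp
      obtain K where K: "closed K" "K \<subseteq> En n" "emeasure lebesgue (En n - K) < ennreal \<epsilon>"
        using sets_lebesgue_inner_closed[OF EnL \<epsilon>] by metis
      obtain V0 where V0: "open V0" "En n \<subseteq> V0" "emeasure lebesgue (V0 - En n) < ennreal \<epsilon>"
        using sets_lebesgue_outer_open[OF EnL \<epsilon>] by metis
      define V where "V = V0 \<inter> ball 0 (real n)"
      have V: "open V" "En n \<subseteq> V" "bounded V" "V \<subseteq> V0"
        using V0 bounded_subset[of "ball 0 (real n)" V] by (auto simp: V_def En_def)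
      have "bounded K" using K(2) V(2,3) bounded_subset by blast
      then have cK: "compact K" using K(1) compact_eq_bounded_closed by blast
      have [measurable]: "K \<in> sets borel" "V \<in> sets borel" using K(1) V(1) by auto
      have "emeasure lborel V < \<infinity>" using V(3) emeasure_bounded_finite by auto
      have finS: "emeasure lborel S < \<infinity>" if "S \<subseteq> V" for S
        using emeasure_mono[OF that, of lborel] \<open>emeasure lborel V < \<infinity>\<close> le_less_trans by simp
      have finK: "emeasure lborel K < \<infinity>" using finS K(2) V(2) by blast
      have mK: "measure lborel (En n - K) < \<epsilon>"
        using K(3) by (intro measure_less_if_emeasure_less) simp
      have "emeasure lebesgue (V - En n) \<le> emeasure lebesgue (V0 - En n)"
        using V(4) V0(1) by (intro emeasure_mono) auto
      then have "emeasure lborel (V - En n) \<le> emeasure lebesgue (V0 - En n)" by simp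
      then have mV: "measure lborel (V - En n) < \<epsilon>"
        using V0(3) by (intro measure_less_if_emeasure_less) (rule le_less_trans)
      define m where "m = measure lborel K"
      have mKE: "m \<ge> measure lborel (En n) - \<epsilon>"
        using measure_Diff[of lborel "En n" K] fin finK mK K(2) by (auto simp: m_def)
      \<comment> \<open>Adding 1 avoids a division by zero if \<open>K\<close> is a null set; only \<open>\<eta> m \<le> \<epsilon>\<close> matters.\<close>
      define \<eta> where "\<eta> = \<epsilon> / (m + 1)"
      have m0: "m \<ge> 0" by (simp add: m_def)
      have \<eta>: "\<eta> > 0" "\<eta> * m \<le> \<epsilon>" using \<epsilon> m0 by (auto simp: \<eta>_def field_simps)
      have KV: "K \<subseteq> V" using K V by blast
      obtain f where f: "\<And>k. smooth_k k f" "\<And>x. 0 \<le> f x" "\<And>x. f x \<le> 1"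
        "\<And>x. x \<notin> V \<Longrightarrow> f x = 0" "\<And>x. x \<in> K \<Longrightarrow> 1 - \<eta> \<le> f x"
        by (rule smooth_bump_approximates_compact[OF cK V(1) KV \<eta>(1)]) blast
      have "continuous_on UNIV f" using f(1)[of 0] by simp
      then have [measurable]: "f \<in> borel_measurable borel"
        by (rule borel_measurable_continuous_onI)
      define Uh where "Uh = {x. x - h \<in> U}"
      have [measurable]: "Uh \<in> sets borel" unfolding Uh_def by measurable
      have intV: "integrable lborel (indicator V :: _ \<Rightarrow> real)"
        using \<open>emeasure lborel V < \<infinity>\<close> by simp
      have intf: "integrable lborel (\<lambda>x. indicator S x * f x)" if [measurable]: "S \<in> sets borel" for S
        by (rule Bochner_Integration.integrable_bound[OF intV])
          (use f in \<open>auto simp: indicator_def split: if_splits\<close>)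
      have "(LINT x:U|lborel. f (x + h)) - (LINT x:U|lborel. f x)
          = (\<integral>x. indicator Uh x * f x - indicator U x * f x \<partial>lborel)"
        unfolding Uh_def using intf[of UNIV] by (intro set_integral_shift_eq U) simp
      also have "\<dots> \<ge> (\<integral>x. (1 - \<eta>) * indicator K x - indicator (V - En n) x \<partial>lborel)"
      proof (rule integral_mono)
        show "integrable lborel (\<lambda>x. (1 - \<eta>) * indicator K x - indicator (V - En n) x :: real)"
          using finK finS[of "V - En n"]
          by (intro Bochner_Integration.integrable_diff integrable_mult_right integrable_real_indicator) auto
        show "(1 - \<eta>) * indicator K x - indicator (V - En n) x
            \<le> indicator Uh x * f x - indicator U x * f x" for x
          using f(2,3,4,5)[of x] K(2) V(2)
          by (auto simp: indicator_def En_def E_def Uh_def V_def)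
      qed (intro Bochner_Integration.integrable_diff intf; measurable)
      finally have "(1 - \<eta>) * m - measure lborel (V - En n)
          \<le> (LINT x:U|lborel. f (x + h)) - (LINT x:U|lborel. f x)"
        using finK finS[of "V - En n"] by (simp add: m_def)
      also have "\<dots> \<le> norm h * P"
        using f by (intro set_integral_shift_le_perimeter[OF U P f(1) _ V(3)]) auto
      finally show ?thesis using mV mKE \<eta>(2) by (simp add: algebra_simps)
    qed
    have "measure lborel (En n) \<le> norm h * P + e" if "e > 0" for e
      using main[of "e / 3"] that by simp
    then have "measure lborel (En n) \<le> norm h * P" by (rule field_le_epsilon)
    then have "ennreal (measure lborel (En n)) \<le> ennreal (norm h * P)" by (rule ennreal_leI)
    then show ?thesis using fin by (simp add: emeasure_eq_ennreal_measure)
  qed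
  then have "(SUP n. emeasure lborel (En n)) \<le> ennreal (norm h * P)"
    by (rule SUP_least)
  moreover have "(SUP n. emeasure lborel (En n)) = emeasure lborel (\<Union>n. En n)"
    by (rule SUP_emeasure_incseq) (force simp: incseq_def En_def)+
  moreover have "(\<Union>n. En n) = E"
  proof (rule equalityI; rule subsetI)
    fix x assume "x \<in> E"
    moreover obtain n where "norm x < real n" using reals_Archimedean2 by blast
    ultimately show "x \<in> (\<Union>n. En n)" by (auto simp: En_def)
  qed (auto simp: En_def)
  ultimately have "emeasure lborel E \<le> ennreal (norm h * P)"
    by simp
  then show ?thesis
    using P by (simp add: E_def ennreal_mult)
qed

section \<open>Averages of translation differences\<close>

text \<open>This is \<open>(A - h) \<triangle> A\<close>, written as a condition on \<open>x\<close> and \<open>h\<close> so that Fubini can exchange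
  the roles of the point and the translation.\<close>

definition shift_diff :: "'a::real_normed_vector set \<Rightarrow> 'a \<Rightarrow> 'a set" where
  "shift_diff A h = {x. (x + h \<in> A) \<noteq> (x \<in> A)}"

lemma shift_diff_borel[measurable]:
  fixes A :: "'a::euclidean_space set"
  assumes [measurable]: "A \<in> sets borel"
  shows "shift_diff A h \<in> sets borel"
  unfolding shift_diff_def by measurable

lemma emeasure_eq_nn_integral:
  assumes "X \<in> sets M" "\<And>x. g x = indicator X x"
  shows "emeasure M X = (\<integral>\<^sup>+x. g x \<partial>M)"
  using assms by simp

lemma fmeasurable_lborel_ball: "ball (c::'a::euclidean_space) r \<in> fmeasurable lborel"
  by (intro fmeasurableI) (auto intro: emeasure_lborel_ball_finite[unfolded infinity_ennreal_def])

text \<open>By Fubini both sides compare integrals over pairs \<open>(x, y)\<close> with \<open>y \<in> E\<close>: integrating in \<open>x\<close>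
  first turns the inner integral into the measure of \<^term>\<open>shift_diff A y\<close>. Taking for \<open>E\<close> a
  ball gives the \<open>L\<^sup>1\<close> distance of \<open>A\<close> to its averages; taking for \<open>E\<close> the difference of two
  balls gives the \<open>L\<^sup>1\<close> modulus of continuity of these averages.\<close>

lemma nn_integral_shift_diff_le:
  fixes A E :: "'a::euclidean_space set"
  assumes A[measurable]: "A \<in> sets borel" and E[measurable]: "E \<in> sets borel"
    and S: "\<And>y. y \<in> E \<Longrightarrow> emeasure lborel (shift_diff A y) \<le> S"
  shows "(\<integral>\<^sup>+x. emeasure lborel {y \<in> E. (x + y \<in> A) \<noteq> (x \<in> A)} \<partial>lborel) \<le> emeasure lborel E * S"
proof -
  let ?g = "\<lambda>x y. indicator E y * indicator {p. (fst p + snd p \<in> A) \<noteq> (fst p \<in> A)} (x, y) :: ennreal"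
  have "{y \<in> E. (x + y \<in> A) \<noteq> (x \<in> A)} \<in> sets borel" for x by measurable
  then have "emeasure lborel {y \<in> E. (x + y \<in> A) \<noteq> (x \<in> A)} = (\<integral>\<^sup>+y. ?g x y \<partial>lborel)" for x
    by (intro emeasure_eq_nn_integral) (auto simp: indicator_def)
  then have "(\<integral>\<^sup>+x. emeasure lborel {y \<in> E. (x + y \<in> A) \<noteq> (x \<in> A)} \<partial>lborel)
      = (\<integral>\<^sup>+x. (\<integral>\<^sup>+y. ?g x y \<partial>lborel) \<partial>lborel)" by simp
  also have "\<dots> = (\<integral>\<^sup>+y. (\<integral>\<^sup>+x. ?g x y \<partial>lborel) \<partial>lborel)"
    by (rule lborel_pair.Fubini'[symmetric]) (auto simp: split_beta' intro!: borel_measurable_times_ennreal)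
  also have "\<dots> = (\<integral>\<^sup>+y. indicator E y * emeasure lborel (shift_diff A y) \<partial>lborel)"
  proof (rule nn_integral_cong)
    fix y
    have "(\<integral>\<^sup>+x. ?g x y \<partial>lborel) = (\<integral>\<^sup>+x. indicator E y * indicator (shift_diff A y) x \<partial>lborel)"
      by (rule nn_integral_cong) (simp add: indicator_def shift_diff_def)
    then show "(\<integral>\<^sup>+x. ?g x y \<partial>lborel) = indicator E y * emeasure lborel (shift_diff A y)"
      by (simp add: nn_integral_cmult)
  qed
  also have "\<dots> \<le> (\<integral>\<^sup>+y. indicator E y * S \<partial>lborel)"
    by (rule nn_integral_mono) (auto simp: indicator_def S)
  also have "\<dots> = emeasure lborel E * S"
    by (simp add: nn_integral_multc)
  finally show ?thesis .
qed

text \<open>The layer cake formula: for fixed \<open>x\<close> the levels \<open>l\<close> that separate \<open>v x\<close> from \<open>w x\<close> form an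
  interval of length \<open>|v x - w x|\<close>. For \<open>w\<close> a translate of \<open>v\<close> it says that the
  superlevel sets move on average as fast as \<open>v\<close> changes in \<open>L\<^sup>1\<close>.\<close>

lemma nn_integral_level_sets_diff:
  fixes v w :: "'a::euclidean_space \<Rightarrow> real"
  assumes [measurable]: "v \<in> borel_measurable borel" "w \<in> borel_measurable borel"
  shows "(\<integral>\<^sup>+l. emeasure lborel {x. (l < v x) \<noteq> (l < w x)} \<partial>lborel) = (\<integral>\<^sup>+x. ennreal \<bar>v x - w x\<bar> \<partial>lborel)"
    and "(\<lambda>l. emeasure lborel {x. (l < v x) \<noteq> (l < w x)}) \<in> borel_measurable lborel"
proof -
  let ?g = "\<lambda>l x. indicator {p. (fst p < v (snd p)) \<noteq> (fst p < w (snd p))} (l, x) :: ennreal"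
  have "{x. (l < v x) \<noteq> (l < w x)} \<in> sets borel" for l by measurable
  then have e: "emeasure lborel {x. (l < v x) \<noteq> (l < w x)} = (\<integral>\<^sup>+x. ?g l x \<partial>lborel)" for l
    by (intro emeasure_eq_nn_integral) (auto simp: indicator_def)
  have m: "case_prod ?g \<in> borel_measurable (lborel \<Otimes>\<^sub>M lborel)"
    unfolding split_beta' by measurable
  show "(\<lambda>l. emeasure lborel {x. (l < v x) \<noteq> (l < w x)}) \<in> borel_measurable lborel"
    unfolding e using lborel.borel_measurable_nn_integral_fst[OF m] by simp
  have "(\<integral>\<^sup>+l. (\<integral>\<^sup>+x. ?g l x \<partial>lborel) \<partial>lborel) = (\<integral>\<^sup>+x. (\<integral>\<^sup>+l. ?g l x \<partial>lborel) \<partial>lborel)"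
    by (rule lborel_pair.Fubini'[OF m, symmetric])
  also have "\<dots> = (\<integral>\<^sup>+x. ennreal \<bar>v x - w x\<bar> \<partial>lborel)"
  proof (rule nn_integral_cong)
    fix x
    have "(\<integral>\<^sup>+l. ?g l x \<partial>lborel) = (\<integral>\<^sup>+l. indicator {min (v x) (w x)..<max (v x) (w x)} l \<partial>lborel)"
      by (rule nn_integral_cong) (auto simp: indicator_def)
    also have "\<dots> = ennreal \<bar>v x - w x\<bar>"
      by (simp add: max_def min_def)
    finally show "(\<integral>\<^sup>+l. ?g l x \<partial>lborel) = ennreal \<bar>v x - w x\<bar>" .
  qed
  finally show "(\<integral>\<^sup>+l. emeasure lborel {x. (l < v x) \<noteq> (l < w x)} \<partial>lborel) = (\<integral>\<^sup>+x. ennreal \<bar>v x - w x\<bar> \<partial>lborel)"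
    unfolding e .
qed

lemma exists_le_average:
  fixes f :: "real \<Rightarrow> ennreal"
  assumes [measurable]: "f \<in> borel_measurable borel" and ab: "a < b"
    and M: "(\<integral>\<^sup>+l. indicator {a<..<b} l * f l \<partial>lborel) \<le> M"
  shows "\<exists>l\<in>{a<..<b}. f l \<le> M / ennreal (b - a)"
proof (cases "M = \<infinity>")
  case True
  then show ?thesis using ab dense[OF ab] by (auto simp: ennreal_top_divide)
next
  case False
  show ?thesis
  proof (rule ccontr)
    assume "\<not> ?thesis"
    then have gt: "\<And>l. l \<in> {a<..<b} \<Longrightarrow> M / ennreal (b - a) < f l" by (auto simp: not_le)
    have i: "(\<integral>\<^sup>+l. M / ennreal (b - a) * indicator {a<..<b} l \<partial>lborel) = M"
      using ab by (subst nn_integral_cmult_indicator) (auto simp: ennreal_divide_times ennreal_mult_divide_eq)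
    have "(\<integral>\<^sup>+l. M / ennreal (b - a) * indicator {a<..<b} l \<partial>lborel)
        < (\<integral>\<^sup>+l. indicator {a<..<b} l * f l \<partial>lborel)"
    proof (rule nn_integral_less)
      show "(\<integral>\<^sup>+l. M / ennreal (b - a) * indicator {a<..<b} l \<partial>lborel) \<noteq> \<infinity>"
        unfolding i using False .
      show "AE l in lborel. M / ennreal (b - a) * indicator {a<..<b} l \<le> indicator {a<..<b} l * f l"
        using gt by (auto simp: indicator_def less_imp_le)
      show "\<not> (AE l in lborel. indicator {a<..<b} l * f l \<le> M / ennreal (b - a) * indicator {a<..<b} l)"
      proof
        assume "AE l in lborel. indicator {a<..<b} l * f l \<le> M / ennreal (b - a) * indicator {a<..<b} l"
        then have "AE l in lborel. l \<notin> {a<..<b}"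
          by eventually_elim (use gt in \<open>force simp: not_le[symmetric]\<close>)
        then have "emeasure lborel {a<..<b} = 0"
          by (simp add: AE_iff_measurable[OF _ refl] greaterThanLessThan_def lessThan_def greaterThan_def Int_def conj_commute)
        then show False using ab by simp
      qed
    qed measurable
    with i M show False by simp
  qed
qed

lemma abs_measure_diff_le:
  assumes "A \<in> fmeasurable M" "B \<in> fmeasurable M"
  shows "\<bar>measure M A - measure M B\<bar> \<le> measure M (sym_diff A B)"
proof -
  have s: "sym_diff A B \<in> fmeasurable M" using assms by auto
  have "measure M A \<le> measure M (B \<union> sym_diff A B)"
    using assms s by (intro measure_mono_fmeasurable) auto
  also have "\<dots> \<le> measure M B + measure M (sym_diff A B)"
    using assms s by (intro measure_Un_le) auto
  finally have 1: "measure M A \<le> measure M B + measure M (sym_diff A B)" .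
  have "measure M B \<le> measure M (A \<union> sym_diff A B)"
    using assms s by (intro measure_mono_fmeasurable) auto
  also have "\<dots> \<le> measure M A + measure M (sym_diff A B)"
    using assms s by (intro measure_Un_le) auto
  finally show ?thesis using 1 by linarith
qed

text \<open>Translating \<open>x\<close> amounts to translating the window \<open>B\<close>, and the two windows agree off their
  difference. Counting the points of \<open>A\<close> if \<open>x \<notin> A\<close>, and the points outside \<open>A\<close> if \<open>x \<in> A\<close>,
  keeps on the right only those \<open>y\<close> for which \<open>x + y\<close> and \<open>x\<close> lie on different sides of \<open>A\<close>.
  Because the translated window has the same measure, both counts change by the same amount.
  Without the restriction to such \<open>y\<close> the integral over \<open>x\<close> would in general be infinite.\<close>

lemma window_measure_shift_le:
  fixes A B :: "'a::euclidean_space set"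
  assumes A[measurable]: "A \<in> sets borel" and B[measurable]: "B \<in> sets borel" and bB: "bounded B"
  shows "\<bar>measure lborel {y \<in> B. x + h + y \<in> A} - measure lborel {y \<in> B. x + y \<in> A}\<bar>
    \<le> measure lborel {y \<in> shift_diff B (- h). (x + y \<in> A) \<noteq> (x \<in> A)}"
proof -
  define Bh where "Bh = {y. y + (- h) \<in> B}"
  have [measurable]: "Bh \<in> sets borel" unfolding Bh_def by measurable
  have eB: "emeasure lborel Bh = emeasure lborel B" unfolding Bh_def by (rule lborel_emeasure_translate) simp
  have fB: "B \<in> fmeasurable lborel" using bB emeasure_bounded_finite by (intro fmeasurableI) auto
  then have fBh: "Bh \<in> fmeasurable lborel" using eB by (auto simp: fmeasurable_def)
  have sub: "X \<in> fmeasurable lborel" if "X \<subseteq> B \<or> X \<subseteq> Bh" "X \<in> sets borel" for X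
    using that fB fBh fmeasurableI2[of B lborel X] fmeasurableI2[of Bh lborel X] by auto
  have mB: "measure lborel Bh = measure lborel B" using eB by (simp add: measure_def)
  have "measure lborel {y \<in> B. x + h + y \<in> A} = measure lborel {y. y + (- h) \<in> {y \<in> B. x + h + y \<in> A}}"
    unfolding measure_def by (subst lborel_emeasure_translate) auto
  also have "{y. y + (- h) \<in> {y \<in> B. x + h + y \<in> A}} = {y \<in> Bh. x + y \<in> A}"
    by (auto simp: Bh_def algebra_simps)
  finally have v: "measure lborel {y \<in> B. x + h + y \<in> A} = measure lborel {y \<in> Bh. x + y \<in> A}" .
  show ?thesis
  proof (cases "x \<in> A")
    case False
    have "sym_diff {y \<in> Bh. x + y \<in> A} {y \<in> B. x + y \<in> A} =
        {y \<in> shift_diff B (- h). (x + y \<in> A) \<noteq> (x \<in> A)}"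
      using False by (auto simp: shift_diff_def Bh_def)
    then show ?thesis
      unfolding v using abs_measure_diff_le[of "{y \<in> Bh. x + y \<in> A}" lborel "{y \<in> B. x + y \<in> A}"]
      by (simp add: sub subset_eq)
  next
    case True
    have c: "measure lborel {y \<in> X. x + y \<in> A} = measure lborel X - measure lborel {y \<in> X. x + y \<notin> A}"
      if "X \<in> fmeasurable lborel" for X
    proof -
      have [measurable]: "X \<in> sets borel" using that by (simp add: fmeasurable_def)
      have "{y \<in> X. x + y \<in> A} = X - {y \<in> X. x + y \<notin> A}" by auto
      moreover have "{y \<in> X. x + y \<notin> A} \<in> sets lborel" by simp
      ultimately show ?thesis using that
        measurable_measure_Diff[of X lborel "{y \<in> X. x + y \<notin> A}"] by auto
    qed
    have "sym_diff {y \<in> Bh. x + y \<notin> A} {y \<in> B. x + y \<notin> A} =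
        {y \<in> shift_diff B (- h). (x + y \<in> A) \<noteq> (x \<in> A)}"
      using True by (auto simp: shift_diff_def Bh_def)
    then have "\<bar>measure lborel {y \<in> Bh. x + y \<notin> A} - measure lborel {y \<in> B. x + y \<notin> A}\<bar>
        \<le> measure lborel {y \<in> shift_diff B (- h). (x + y \<in> A) \<noteq> (x \<in> A)}"
      using abs_measure_diff_le[of "{y \<in> Bh. x + y \<notin> A}" lborel "{y \<in> B. x + y \<notin> A}"]
      by (simp add: sub subset_eq)
    then show ?thesis
      unfolding v c[OF fB] c[OF fBh] mB by linarith
  qed
qed

lemma one_plus_power_le:
  fixes x :: real
  assumes "0 \<le> x" "x \<le> 1"
  shows "(1 + x) ^ n \<le> 1 + 2 ^ n * x"
proof -
  have "(1 + x) ^ n \<le> 1 + (2 ^ n - 1) * x"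
  proof (induction n)
    case (Suc n)
    have "(1 + x) ^ Suc n \<le> (1 + x) * (1 + (2 ^ n - 1) * x)"
      using assms Suc by (simp add: mult_left_mono)
    also have "\<dots> = 1 + x + (2 ^ n - 1) * x + (2 ^ n - 1) * (x * x)" by (simp add: algebra_simps)
    also have "(2 ^ n - 1) * (x * x) \<le> (2 ^ n - 1) * x"
      using assms by (intro mult_left_mono) (auto simp: mult_left_le)
    finally show ?case by (simp add: algebra_simps)
  qed simp
  then show ?thesis using assms by (simp add: algebra_simps)
qed

text \<open>Points in one of the two balls only lie in the annulus between the radii \<open>r - |h|\<close> and
  \<open>r + |h|\<close>, whose volume is of order \<open>|h|\<close>.\<close>

lemma measure_shift_diff_ball_le:
  fixes h :: "'a::euclidean_space"
  assumes r: "r > 0" and h: "norm h \<le> r"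
  shows "measure lborel (shift_diff (ball 0 r) h)
    \<le> 2 ^ (DIM('a) + 1) * (norm h / r) * measure lborel (ball (0::'a) r)"
proof -
  define s x where "s = norm h" and "x = s / r"
  have x: "0 \<le> x" "x \<le> 1" using r h by (auto simp: x_def s_def)
  have sr: "r + s = r * (1 + x)" "r - s = r * (1 - x)" using r by (auto simp: x_def field_simps)
  have "shift_diff (ball 0 r) h \<subseteq> ball 0 (r + s) - ball 0 (r - s)"
  proof
    fix y assume "y \<in> shift_diff (ball 0 r) h"
    then have "(norm (y + h) < r) \<noteq> (norm y < r)" by (simp add: shift_diff_def)
    moreover have "norm (y + h) \<le> norm y + norm h" "norm y \<le> norm (y + h) + norm h"
      using norm_triangle_ineq[of y h] norm_triangle_ineq4[of "y + h" h] by auto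
    ultimately show "y \<in> ball 0 (r + s) - ball 0 (r - s)" by (auto simp: s_def)
  qed
  then have "measure lborel (shift_diff (ball 0 r) h) \<le> measure lborel (ball (0::'a) (r + s) - ball 0 (r - s))"
    by (intro measure_mono_fmeasurable) (auto intro!: fmeasurable.Diff fmeasurable_lborel_ball)
  also have "\<dots> = measure lborel (ball (0::'a) (r + s)) - measure lborel (ball (0::'a) (r - s))"
    using norm_ge_zero[of h]
    by (intro measurable_measure_Diff subset_ball) (auto simp: s_def fmeasurable_lborel_ball)
  also have "\<dots> = ((1 + x) ^ DIM('a) - (1 - x) ^ DIM('a)) * measure lborel (ball (0::'a) r)"
  proof -
    have scale: "measure lborel (ball (0::'a) (r * c)) = c ^ DIM('a) * measure lborel (ball (0::'a) r)" if "c \<ge> 0" for c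
      using content_ball_conv_unit_ball[of "r * c" "0::'a"] content_ball_conv_unit_ball[of r "0::'a"] r that
      by (simp add: power_mult_distrib)
    show ?thesis using x unfolding sr by (subst (1 2) scale) (auto simp: left_diff_distrib)
  qed
  also have "\<dots> \<le> (2 ^ (DIM('a) + 1) * x) * measure lborel (ball (0::'a) r)"
  proof (rule mult_right_mono)
    have "1 - real DIM('a) * x \<le> (1 - x) ^ DIM('a)"
      using Bernoulli_inequality[of "- x" "DIM('a)"] x by simp
    moreover have "real DIM('a) * x \<le> 2 ^ DIM('a) * x"
      using x by (intro mult_right_mono) (auto intro: less_imp_le of_nat_less_two_power)
    moreover have "(1 + x) ^ DIM('a) \<le> 1 + 2 ^ DIM('a) * x" by (rule one_plus_power_le[OF x])
    ultimately show "(1 + x) ^ DIM('a) - (1 - x) ^ DIM('a) \<le> 2 ^ (DIM('a) + 1) * x" by simp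
  qed simp
  finally show ?thesis by (simp add: x_def s_def)
qed

section \<open>The upper bound\<close>

lemma set_integral_shift_le_shift_diff:
  fixes f :: "'a::euclidean_space \<Rightarrow> real"
  assumes U[measurable]: "U \<in> sets borel" and f: "integrable lborel f" "\<And>x. \<bar>f x\<bar> \<le> 1"
  shows "ennreal ((LINT x:U|lborel. f (x + h)) - (LINT x:U|lborel. f x))
    \<le> emeasure lborel (shift_diff U (- h))"
proof (cases "emeasure lborel (shift_diff U (- h)) = \<infinity>")
  case False
  define Uh where "Uh = {x. x - h \<in> U}"
  have [measurable]: "Uh \<in> sets borel" unfolding Uh_def by measurable
  have [measurable]: "f \<in> borel_measurable borel" using f(1) by simp
  have int: "integrable lborel (\<lambda>x. indicator X x * f x)" if "X \<in> sets borel" for X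
    using integrable_mult_indicator[OF _ f(1), of X] that by simp
  have "(LINT x:U|lborel. f (x + h)) - (LINT x:U|lborel. f x)
      = (\<integral>x. indicator Uh x * f x - indicator U x * f x \<partial>lborel)"
    unfolding Uh_def by (rule set_integral_shift_eq[OF U f(1)])
  also have "\<dots> \<le> (\<integral>x. indicator (shift_diff U (- h)) x \<partial>lborel)"
  proof (rule integral_mono)
    show "integrable lborel (indicator (shift_diff U (- h)) :: _ \<Rightarrow> real)"
      using False by (intro integrable_real_indicator) (auto simp: top.not_eq_extremum)
    show "indicator Uh x * f x - indicator U x * f x \<le> indicator (shift_diff U (- h)) x" for x
      using f(2)[of x] by (auto simp: indicator_def Uh_def shift_diff_def)
  qed (intro Bochner_Integration.integrable_diff int; measurable)
  finally have "(LINT x:U|lborel. f (x + h)) - (LINT x:U|lborel. f x)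
      \<le> measure lborel (shift_diff U (- h))" by simp
  then have "ennreal ((LINT x:U|lborel. f (x + h)) - (LINT x:U|lborel. f x))
      \<le> ennreal (measure lborel (shift_diff U (- h)))" by (rule ennreal_leI)
  then show ?thesis using False by (simp add: emeasure_eq_ennreal_measure)
qed simp

lemma ennreal_sum_le: "ennreal (sum a I) \<le> (\<Sum>i\<in>I. ennreal (a i))"
proof -
  have "ennreal (sum a I) \<le> ennreal (\<Sum>i\<in>I. max 0 (a i))"
    by (intro ennreal_leI sum_mono) simp
  also have "\<dots> = (\<Sum>i\<in>I. ennreal (max 0 (a i)))" by (subst sum_ennreal) auto
  also have "\<dots> = (\<Sum>i\<in>I. ennreal (a i))" by (rule sum.cong) (auto simp: max_def ennreal_neg)
  finally show ?thesis .
qed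

text \<open>For a test field \<open>\<Phi>\<close>, the integral of \<open>\<partial>\<^sub>i \<Phi>\<^sub>i\<close> over \<open>U\<close> is the limit of the difference quotients
  \<open>(\<integral>\<^sub>U \<Phi>\<^sub>i(x + s e\<^sub>i) dx - \<integral>\<^sub>U \<Phi>\<^sub>i(x) dx)/s\<close>, and as \<open>|\<Phi>\<^sub>i| \<le> 1\<close> each quotient is at most
  \<open>|(U + s e\<^sub>i) \<triangle> U|/s\<close>. A sequence of values \<open>s\<close> common to all directions suffices, and a
  lower limit is what Fatou's lemma later provides.\<close>

lemma perimeter_le_liminf_shift_diff:
  fixes U :: "(real ^ 'n::finite) set"
  assumes U[measurable]: "U \<in> sets borel"
  shows "perimeter U \<le> liminf (\<lambda>n. \<Sum>i\<in>UNIV.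
    ennreal (real (Suc n)) * emeasure lborel (shift_diff U (- (inverse (real (Suc n)) *\<^sub>R axis i 1))))"
    (is "_ \<le> liminf ?b")
  unfolding perimeter_def
proof (rule SUP_least)
  fix \<Phi> :: "real ^ 'n \<Rightarrow> real ^ 'n"
  assume "\<Phi> \<in> {\<Phi>. test_field \<Phi> \<and> (\<forall>x. norm (\<Phi> x) \<le> 1)}"
  then have T: "test_field \<Phi>" and \<Phi>1: "\<And>x. norm (\<Phi> x) \<le> 1" by auto
  define B where "B = closure {x. \<Phi> x \<noteq> 0}"
  have B: "compact B" using T by (simp add: test_field_def B_def)
  have off: "\<Phi> x = 0" if "x \<notin> B" for x
    using that closure_subset[of "{x. \<Phi> x \<noteq> 0}"] by (auto simp: B_def)
  define D where "D = (\<lambda>x. frechet_derivative \<Phi> (at x))"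
  have ck: "C_k (Suc 0) \<Phi>" using T by (simp only: test_field_def)
  then have d\<Phi>: "(\<Phi> has_derivative D x) (at x)" for x
    by (simp add: D_def frechet_derivative_works[symmetric])
  then have di: "((\<lambda>x. \<Phi> x $ i) has_derivative (\<lambda>h. D x h $ i)) (at x)" for x i
    by (rule bounded_linear.has_derivative[OF bounded_linear_vec_nth])
  have contD: "continuous_on UNIV (\<lambda>x. D x (axis i 1) $ i)" for i
    using ck by (intro continuous_on_component) (simp add: D_def)
  have D0: "D x (axis i 1) $ i = 0" if "x \<notin> B" for x i
  proof -
    have "(\<lambda>h. D x h $ i) = (\<lambda>_. 0)"
    proof (rule has_derivative_zero_off_support[OF di])
      show "x \<notin> closure B" using that by (simp add: B_def)
    qed (simp add: off)
    then show ?thesis by meson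
  qed
  have int_off: "integrable lborel g" if "continuous_on UNIV g" "\<And>x. x \<notin> B \<Longrightarrow> g x = 0"
    for g :: "real ^ 'n \<Rightarrow> real"
  proof -
    have "integrable lborel (\<lambda>x. indicator B x *\<^sub>R g x)"
      using B that(1) continuous_on_subset by (intro borel_integrable_compact) blast+
    moreover have "(\<lambda>x. indicator B x *\<^sub>R g x) = g"
      using that(2) by (auto simp: indicator_def fun_eq_iff)
    ultimately show ?thesis by (simp only:)
  qed
  define F where "F = (\<lambda>i s. LINT x:U|lborel. \<Phi> (x + s *\<^sub>R axis i 1) $ i)"
  define d where "d = (\<lambda>i. LINT x:U|lborel. D x (axis i 1) $ i)"
  have "(LINT x:U|lebesgue. divergence \<Phi> x) = (LINT x:U|lborel. divergence \<Phi> x)"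
    by (intro set_integral_lebesgue_eq_lborel assms borel_measurable_continuous_onI
        continuous_on_divergence T)
  also have "\<dots> = (\<Sum>i\<in>UNIV. d i)"
  proof -
    have "integrable lborel (\<lambda>x. indicator U x *\<^sub>R D x (axis i 1) $ i)" for i
      using integrable_mult_indicator[OF _ int_off[OF contD D0], of U] by simp
    then have "(\<integral>x. (\<Sum>i\<in>UNIV. indicator U x *\<^sub>R D x (axis i 1) $ i) \<partial>lborel) = (\<Sum>i\<in>UNIV. d i)"
      unfolding d_def set_lebesgue_integral_def by (intro Bochner_Integration.integral_sum) simp
    then show ?thesis
      unfolding divergence_def[abs_def] set_lebesgue_integral_def scaleR_sum_right D_def .
  qed
  finally have div: "(LINT x:U|lebesgue. divergence \<Phi> x) = (\<Sum>i\<in>UNIV. d i)" .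
  have "(F i has_real_derivative d i) (at 0)" for i
    using DERIV_set_integral_translate[of "\<lambda>x. \<Phi> x $ i" "\<lambda>x h. D x h $ i" "axis i 1" B U 0,
        OF di contD compact_imp_bounded[OF B] _ U] off
    by (simp add: F_def d_def)
  then have "(\<lambda>n. (F i (inverse (real (Suc n))) - F i 0) / inverse (real (Suc n))) \<longlonglongrightarrow> d i" for i
    using LIMSEQ_inverse_real_of_nat
    unfolding has_field_derivative_iff tendsto_at_iff_sequentially comp_def by simp
  then have "(\<lambda>n. \<Sum>i\<in>UNIV. (F i (inverse (real (Suc n))) - F i 0) / inverse (real (Suc n)))
      \<longlonglongrightarrow> (\<Sum>i\<in>UNIV. d i)" (is "?a \<longlonglongrightarrow> _") by (intro tendsto_sum)
  then have "(\<lambda>n. ennreal (?a n)) \<longlonglongrightarrow> ennreal (\<Sum>i\<in>UNIV. d i)" by (rule tendsto_ennrealI)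
  then have "ennreal (\<Sum>i\<in>UNIV. d i) = liminf (\<lambda>n. ennreal (?a n))"
    by (intro lim_imp_Liminf[symmetric]) auto
  also have "\<dots> \<le> liminf ?b"
  proof (intro Liminf_mono always_eventually allI)
    fix n
    have "ennreal (?a n) \<le> (\<Sum>i\<in>UNIV. ennreal ((F i (inverse (real (Suc n))) - F i 0) / inverse (real (Suc n))))"
      by (rule ennreal_sum_le)
    also have "\<dots> \<le> ?b n"
    proof (rule sum_mono)
      fix i :: 'n
      have c: "continuous_on UNIV (\<lambda>x. \<Phi> x $ i)"
        by (intro continuous_at_imp_continuous_on ballI has_derivative_continuous[OF di])
      have "ennreal (F i (inverse (real (Suc n))) - F i 0)
          \<le> emeasure lborel (shift_diff U (- (inverse (real (Suc n)) *\<^sub>R axis i 1)))"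
        using set_integral_shift_le_shift_diff[OF U int_off[OF c], of "inverse (real (Suc n)) *\<^sub>R axis i 1"]
          off order_trans[OF component_le_norm_cart \<Phi>1]
        by (simp add: F_def)
      then have "ennreal (real (Suc n)) * ennreal (F i (inverse (real (Suc n))) - F i 0)
          \<le> ennreal (real (Suc n)) * emeasure lborel (shift_diff U (- (inverse (real (Suc n)) *\<^sub>R axis i 1)))"
        by (rule mult_left_mono) simp
      then show "ennreal ((F i (inverse (real (Suc n))) - F i 0) / inverse (real (Suc n)))
          \<le> ennreal (real (Suc n)) * emeasure lborel (shift_diff U (- (inverse (real (Suc n)) *\<^sub>R axis i 1)))"
        by (simp only: ennreal_mult'[symmetric, OF of_nat_0_le_iff] divide_inverse inverse_inverse_eq mult.commute)
    qed
    finally show "ennreal (?a n) \<le> ?b n" .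
  qed
  finally show "ennreal (LINT x:U|lebesgue. divergence \<Phi> x) \<le> liminf ?b"
    unfolding div .
qed

text \<open>Let \<open>v x\<close> be the measure of the part of \<open>A\<close> in the ball of radius \<open>r = t/2\<close> around \<open>x\<close>, \<open>m\<close> the
  measure of that ball, and \<open>U l\<close> the open set where \<open>v > l\<close>. Every level between \<open>m/4\<close> and
  \<open>3m/4\<close> gives a set close to \<open>A\<close>: at a point of the symmetric difference, at least a quarter of
  the neighbours lies on the other side of \<open>A\<close>. On average over \<open>l\<close>, the sets \<open>U l\<close> change by
  at most \<open>C s S/t\<close> under translation by \<open>s e\<^sub>i\<close>, because \<open>v\<close> does so in \<open>L\<^sup>1\<close>. Fatou's lemma
  produces a level at which the lower limit of the difference quotients, hence the perimeter, is
  controlled. The radius is \<open>t/2\<close> so that the window and its translates by at most \<open>t/2\<close> stay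
  inside the ball of radius \<open>t\<close> in which the hypothesis applies.\<close>

lemma exists_good_level_set:
  fixes A :: "(real ^ 'n::finite) set"
  assumes A[measurable]: "A \<in> sets borel" and t: "t > 0"
    and S: "\<And>y. y \<in> ball 0 t \<Longrightarrow> emeasure lborel (shift_diff A y) \<le> S"
  shows "\<exists>U. open U \<and> emeasure lborel (sym_diff A U) \<le> 4 * S \<and>
    perimeter U \<le> ennreal (real CARD('n) * 2 ^ (CARD('n) + 3) / t) * S"
proof -
  define r where "r = t / 2"
  define B where "B = ball (0 :: real ^ 'n) r"
  define m where "m = measure lborel B"
  define c where "c = 2 ^ (CARD('n) + 1) / r * m"
  define v where "v = (\<lambda>x. measure lborel {y \<in> B. x + y \<in> A})"
  have r: "r > 0" using t by (simp add: r_def)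
  have [measurable]: "B \<in> sets borel" by (simp add: B_def)
  have fB: "B \<in> fmeasurable lborel" unfolding B_def by (rule fmeasurable_lborel_ball)
  have eB: "emeasure lborel B = ennreal m" using fB by (simp add: m_def emeasure_eq_measure2)
  have m: "m > 0" using content_ball_pos[OF r] by (simp add: m_def B_def)
  have c: "c > 0" using m r by (simp add: c_def)
  have fin: "X \<in> fmeasurable lborel" if "X \<in> sets borel" "bounded X" for X :: "(real ^ 'n) set"
    using that emeasure_bounded_finite by (intro fmeasurableI) auto
  have sd_ball: "shift_diff B (- h) \<subseteq> ball 0 t" if "norm h \<le> r" for h
  proof
    fix y assume "y \<in> shift_diff B (- h)"
    then have "norm (y - h) < r \<or> norm y < r" by (auto simp: shift_diff_def B_def)
    moreover have "norm y \<le> norm (y - h) + norm h" using norm_triangle_ineq[of "y - h" h] by simp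
    ultimately show "y \<in> ball 0 t" using that norm_ge_zero[of h] r unfolding r_def by auto
  qed
  have sd: "shift_diff B (- h) \<in> fmeasurable lborel" if "norm h \<le> r" for h
    using sd_ball[OF that] bounded_subset bounded_ball by (intro fin) (auto; blast)+
  have sdm: "measure lborel (shift_diff B (- h)) \<le> c * norm h" if "norm h \<le> r" for h
    using measure_shift_diff_ball_le[OF r, of "- h"] that by (simp add: B_def m_def c_def mult_ac)
  have dv: "ennreal \<bar>v (x + h) - v x\<bar> \<le> emeasure lborel {y \<in> shift_diff B (- h). (x + y \<in> A) \<noteq> (x \<in> A)}"
    "\<bar>v (x + h) - v x\<bar> \<le> c * norm h"
    if h: "norm h \<le> r" for x h
  proof -
    have w: "\<bar>v (x + h) - v x\<bar> \<le> measure lborel {y \<in> shift_diff B (- h). (x + y \<in> A) \<noteq> (x \<in> A)}"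
      unfolding v_def by (rule window_measure_shift_le) (auto simp: B_def)
    have f: "{y \<in> shift_diff B (- h). (x + y \<in> A) \<noteq> (x \<in> A)} \<in> fmeasurable lborel"
      by (rule fmeasurableI2[OF sd[OF h]]) auto
    show "ennreal \<bar>v (x + h) - v x\<bar> \<le> emeasure lborel {y \<in> shift_diff B (- h). (x + y \<in> A) \<noteq> (x \<in> A)}"
      using w f by (simp add: emeasure_eq_measure2 ennreal_leI)
    have "measure lborel {y \<in> shift_diff B (- h). (x + y \<in> A) \<noteq> (x \<in> A)} \<le> measure lborel (shift_diff B (- h))"
      by (rule measure_mono_fmeasurable[OF _ _ sd[OF h]]) (use f in \<open>auto simp: fmeasurable_def\<close>)
    then show "\<bar>v (x + h) - v x\<bar> \<le> c * norm h" using w sdm[OF h] by linarith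
  qed
  \<comment> \<open>Continuity makes the superlevel sets open.\<close>
  have vcont: "isCont v x" for x
  proof -
    have "((\<lambda>h. v (x + h) - v x) \<longlongrightarrow> 0) (at 0)"
    proof (rule Lim_null_comparison)
      show "\<forall>\<^sub>F h in at 0. norm (v (x + h) - v x) \<le> c * norm h"
        using dv(2) r unfolding eventually_at by (intro exI[of _ r]) auto
      show "((\<lambda>h::real ^ 'n. c * norm h) \<longlongrightarrow> 0) (at 0)"
        by (auto intro!: tendsto_eq_intros)
    qed
    then show ?thesis unfolding isCont_iff by (simp add: LIM_zero_iff)
  qed
  then have vc: "continuous_on UNIV v" by (simp add: continuous_at_imp_continuous_on)
  then have [measurable]: "v \<in> borel_measurable borel" by (rule borel_measurable_continuous_onI)
  define U where "U = (\<lambda>l. {x. l < v x})"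
  have openU: "open (U l)" for l
    unfolding U_def by (rule open_Collect_less[OF continuous_on_const vc])
  \<comment> \<open>Markov's inequality for the average over \<open>y \<in> B\<close>.\<close>
  have near: "emeasure lborel (sym_diff A (U l)) \<le> 4 * S" if l: "l \<in> {m/4<..<3*m/4}" for l
  proof -
    have [measurable]: "U l \<in> sets borel" using openU by simp
    have pt: "ennreal (m / 4) * indicator (sym_diff A (U l)) x
        \<le> emeasure lborel {y \<in> B. (x + y \<in> A) \<noteq> (x \<in> A)}" for x
    proof (cases "x \<in> sym_diff A (U l)")
      case True
      have f: "{y \<in> B. P y} \<in> fmeasurable lborel" if "{y \<in> B. P y} \<in> sets borel" for P
        by (rule fmeasurableI2[OF fB]) (use that in auto)
      have "m / 4 \<le> measure lborel {y \<in> B. (x + y \<in> A) \<noteq> (x \<in> A)}"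
      proof (cases "x \<in> A")
        case xA: True
        then have "v x \<le> 3 * m / 4" using True l by (auto simp: U_def)
        moreover have "{y \<in> B. (x + y \<in> A) \<noteq> (x \<in> A)} = B - {y \<in> B. x + y \<in> A}" using xA by auto
        moreover have "measure lborel (B - {y \<in> B. x + y \<in> A}) = m - v x"
          unfolding m_def v_def using fB f by (intro measurable_measure_Diff) auto
        ultimately show ?thesis by simp
      next
        case False
        then have "m / 4 \<le> v x" using True l by (auto simp: U_def)
        then show ?thesis using False by (simp add: v_def)
      qed
      then show ?thesis using True f by (simp add: emeasure_eq_measure2 ennreal_leI)
    qed simp
    have "ennreal (m / 4) * emeasure lborel (sym_diff A (U l))
        = (\<integral>\<^sup>+x. ennreal (m / 4) * indicator (sym_diff A (U l)) x \<partial>lborel)"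
      by (simp add: nn_integral_cmult_indicator)
    also have "\<dots> \<le> (\<integral>\<^sup>+x. emeasure lborel {y \<in> B. (x + y \<in> A) \<noteq> (x \<in> A)} \<partial>lborel)"
      by (intro nn_integral_mono pt)
    also have "\<dots> \<le> emeasure lborel B * S"
    proof (rule nn_integral_shift_diff_le)
      have "B \<subseteq> ball 0 t" unfolding B_def r_def using t by (intro subset_ball) simp
      then show "emeasure lborel (shift_diff A y) \<le> S" if "y \<in> B" for y using S that by blast
    qed simp_all
    finally have "ennreal (m / 4) * emeasure lborel (sym_diff A (U l)) \<le> ennreal m * S" by (simp add: eB)
    then have "ennreal (4 / m) * (ennreal (m / 4) * emeasure lborel (sym_diff A (U l)))
        \<le> ennreal (4 / m) * (ennreal m * S)" by (rule mult_left_mono) simp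
    then show ?thesis using m by (simp add: mult.assoc[symmetric] ennreal_mult'[symmetric])
  qed
  define f where "f = (\<lambda>n l. \<Sum>i\<in>(UNIV :: 'n set). ennreal (real (Suc n)) *
    emeasure lborel (shift_diff (U l) (- (inverse (real (Suc n)) *\<^sub>R axis i 1))))"
  define M where "M = ennreal (real CARD('n) * c) * S"
  have sdU: "shift_diff (U l) h = {x. (l < v (x + h)) \<noteq> (l < v x)}" for l h
    by (simp add: shift_diff_def U_def)
  have level: "(\<lambda>l. emeasure lborel (shift_diff (U l) h)) \<in> borel_measurable lborel"
    "(\<integral>\<^sup>+l. emeasure lborel (shift_diff (U l) h) \<partial>lborel) = (\<integral>\<^sup>+x. ennreal \<bar>v (x + h) - v x\<bar> \<partial>lborel)" for h
    unfolding sdU by (rule nn_integral_level_sets_diff; measurable)+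
  have fm[measurable]: "f n \<in> borel_measurable borel" for n
    unfolding f_def using level(1) by (intro borel_measurable_sum borel_measurable_times_ennreal) auto
  \<comment> \<open>The factor \<open>Suc n\<close> cancels the step length, so the bound is uniform in \<open>n\<close>.\<close>
  have intf: "(\<integral>\<^sup>+l. f n l \<partial>lborel) \<le> M" if n: "inverse (real (Suc n)) \<le> r" for n
  proof -
    define e where "e = inverse (real (Suc n))"
    have one: "ennreal (real (Suc n)) * (\<integral>\<^sup>+x. ennreal \<bar>v (x + (- (e *\<^sub>R axis i 1))) - v x\<bar> \<partial>lborel) \<le> ennreal c * S" for i
    proof -
      define h where "h = - (e *\<^sub>R axis i (1::real))"
      have hn: "norm h = e" by (simp add: h_def e_def norm_axis_1)
      then have h: "norm h \<le> r" using n by (simp add: e_def)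
      have "(\<integral>\<^sup>+x. ennreal \<bar>v (x + h) - v x\<bar> \<partial>lborel)
          \<le> (\<integral>\<^sup>+x. emeasure lborel {y \<in> shift_diff B (- h). (x + y \<in> A) \<noteq> (x \<in> A)} \<partial>lborel)"
        by (intro nn_integral_mono dv(1)[OF h])
      also have "\<dots> \<le> emeasure lborel (shift_diff B (- h)) * S"
        using sd_ball[OF h] by (intro nn_integral_shift_diff_le S) auto
      also have "emeasure lborel (shift_diff B (- h)) \<le> ennreal (c * e)"
        using sd[OF h] sdm[OF h] hn by (simp add: emeasure_eq_measure2 ennreal_leI)
      finally have "(\<integral>\<^sup>+x. ennreal \<bar>v (x + h) - v x\<bar> \<partial>lborel) \<le> ennreal (c * e) * S"
        by (simp add: mult_right_mono)
      then have "ennreal (real (Suc n)) * (\<integral>\<^sup>+x. ennreal \<bar>v (x + h) - v x\<bar> \<partial>lborel)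
          \<le> ennreal (real (Suc n)) * (ennreal (c * e) * S)" by (rule mult_left_mono) simp
      also have "\<dots> = ennreal c * S"
      proof -
        have "ennreal (real (Suc n)) * ennreal (c * e) = ennreal (real (Suc n) * (c * e))"
          by (rule ennreal_mult'[symmetric]) simp
        also have "real (Suc n) * (c * e) = c" by (simp add: e_def)
        finally show ?thesis unfolding mult.assoc[symmetric] by (simp only:)
      qed
      finally show ?thesis unfolding h_def .
    qed
    have "(\<integral>\<^sup>+l. f n l \<partial>lborel) = (\<Sum>i\<in>(UNIV :: 'n set). ennreal (real (Suc n)) *
        (\<integral>\<^sup>+x. ennreal \<bar>v (x + (- (e *\<^sub>R axis i 1))) - v x\<bar> \<partial>lborel))"
      unfolding f_def e_def[symmetric] level(2)[symmetric]
      using level(1) by (subst nn_integral_sum) (auto simp: nn_integral_cmult)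
    also have "\<dots> \<le> (\<Sum>i\<in>(UNIV :: 'n set). ennreal c * S)"
      by (intro sum_mono one)
    also have "\<dots> = M" using c by (simp add: M_def ennreal_mult ennreal_of_nat_eq_real_of_nat mult.assoc)
    finally show ?thesis .
  qed
  have "(\<integral>\<^sup>+l. liminf (\<lambda>n. f n l) \<partial>lborel) \<le> liminf (\<lambda>n. \<integral>\<^sup>+l. f n l \<partial>lborel)"
    by (rule nn_integral_liminf) simp
  also have "\<dots> \<le> liminf (\<lambda>n::nat. M)"
  proof (rule Liminf_mono)
    have "\<forall>\<^sub>F n in sequentially. inverse (real (Suc n)) < r"
      using order_tendstoD(2)[OF LIMSEQ_inverse_real_of_nat r] .
    then show "\<forall>\<^sub>F n in sequentially. (\<integral>\<^sup>+l. f n l \<partial>lborel) \<le> M"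
      by eventually_elim (use intf in auto)
  qed
  also have "\<dots> = M" by (simp add: Liminf_const)
  finally have "(\<integral>\<^sup>+l. indicator {m/4<..<3*m/4} l * liminf (\<lambda>n. f n l) \<partial>lborel) \<le> M"
    by (rule order_trans[rotated]) (auto intro!: nn_integral_mono simp: indicator_def)
  then obtain l where l: "l \<in> {m/4<..<3*m/4}" "liminf (\<lambda>n. f n l) \<le> M / ennreal (3*m/4 - m/4)"
    using exists_le_average[of "\<lambda>l. liminf (\<lambda>n. f n l)" "m/4" "3*m/4" M] m by auto
  have "perimeter (U l) \<le> liminf (\<lambda>n. f n l)"
    unfolding f_def using openU by (intro perimeter_le_liminf_shift_diff) auto
  also have "\<dots> \<le> M / ennreal (m / 2)" using l(2) by simp
  also have "\<dots> = ennreal (real CARD('n) * c / (m / 2)) * S"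
  proof -
    have "M / ennreal (m / 2) = ennreal (real CARD('n) * c) / ennreal (m / 2) * S"
      unfolding M_def divide_ennreal_def by (simp only: mult_ac)
    also have "ennreal (real CARD('n) * c) / ennreal (m / 2) = ennreal (real CARD('n) * c / (m / 2))"
      using m c by (intro divide_ennreal) auto
    finally show ?thesis .
  qed
  also have "real CARD('n) * c / (m / 2) = real CARD('n) * 2 ^ (CARD('n) + 3) / t"
    using m t by (simp add: c_def r_def power_add field_simps)
  finally show ?thesis using near[OF l(1)] openU by blast
qed

lemma penalty_K_le_shift_diff:
  fixes A :: "(real ^ 'n::finite) set"
  assumes A: "A \<in> sets borel" and t: "t > 0"
    and S: "\<And>y. y \<in> ball 0 t \<Longrightarrow> emeasure lborel (shift_diff A y) \<le> S"
  shows "penalty_K t A \<le> ennreal (4 + real CARD('n) * 2 ^ (CARD('n) + 3)) * S"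
proof (cases "S = \<infinity>")
  case True
  then show ?thesis by (simp add: ennreal_mult_top add_nonneg_eq_0_iff)
next
  case False
  define c where "c = real CARD('n) * 2 ^ (CARD('n) + 3)"
  have c: "c \<ge> 0" by (simp add: c_def)
  obtain U where U: "open U" "emeasure lborel (sym_diff A U) \<le> 4 * S"
    "perimeter U \<le> ennreal (c / t) * S"
    using exists_good_level_set[OF A t S] unfolding c_def by blast
  have "ennreal (c / t) * S < \<infinity>" using False by (simp add: ennreal_mult_less_top top.not_eq_extremum)
  then have "finite_perimeter U"
    unfolding finite_perimeter_def using U(3) by (rule le_less_trans[rotated])
  then have "penalty_K t A \<le> emeasure lebesgue (sym_diff A U) + ennreal t * perimeter U"
    unfolding penalty_K_def using U(1) by (intro INF_lower) simp
  also have "emeasure lebesgue (sym_diff A U) = emeasure lborel (sym_diff A U)"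
    using A U(1) by simp
  also have "\<dots> + ennreal t * perimeter U \<le> 4 * S + ennreal t * (ennreal (c / t) * S)"
    using U by (intro add_mono mult_left_mono) auto
  also have "\<dots> = ennreal (4 + c) * S"
    using t c by (simp add: mult.assoc[symmetric] ennreal_mult'[symmetric] distrib_right)
  finally show ?thesis by (simp add: c_def)
qed

section \<open>The lower bound and Lebesgue measurable sets\<close>

lemma emeasure_lebesgue_translate:
  fixes X :: "'a::euclidean_space set"
  shows "emeasure lebesgue ((\<lambda>x. x + h) ` X) = emeasure lebesgue X"
  using emeasure_lebesgue_affine[of 1 h X] by (simp add: add.commute)

lemma sym_diff_translate_eq_shift_diff:
  "sym_diff ((\<lambda>x. x + h) ` A) A = shift_diff A (- h)"
proof -
  have "x \<in> (\<lambda>x. x + h) ` A \<longleftrightarrow> x - h \<in> A" for x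
    by (auto intro: image_eqI[of _ _ "x - h"])
  then show ?thesis by (auto simp: shift_diff_def)
qed

lemma shift_diff_le_perimeter:
  fixes U :: "(real ^ 'n::finite) set"
  assumes U[measurable]: "U \<in> sets borel"
  shows "emeasure lborel (shift_diff U (- h)) \<le> 2 * (ennreal (norm h) * perimeter U)"
proof -
  let ?E = "\<lambda>h. {x. x - h \<in> U \<and> x \<notin> U}"
  have [measurable]: "?E h \<in> sets borel" for h by measurable
  have "shift_diff U (- h) = ?E h \<union> {x. x + (- h) \<in> ?E (- h)}"
    by (auto simp: shift_diff_def)
  moreover have [measurable]: "{x. x + (- h) \<in> ?E (- h)} \<in> sets borel" by measurable
  ultimately have "emeasure lborel (shift_diff U (- h))
      \<le> emeasure lborel (?E h) + emeasure lborel {x. x + (- h) \<in> ?E (- h)}"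
    by (simp only:) (rule emeasure_subadditive; simp)
  also have "emeasure lborel {x. x + (- h) \<in> ?E (- h)} = emeasure lborel (?E (- h))"
    by (rule lborel_emeasure_translate) measurable
  also have "emeasure lborel (?E h) + \<dots>
      \<le> ennreal (norm h) * perimeter U + ennreal (norm (- h)) * perimeter U"
    by (intro add_mono emeasure_translate_diff_le_perimeter U)
  finally show ?thesis by (simp add: mult_2)
qed

text \<open>Triangle inequality: passing from \<open>A\<close> to \<open>U\<close> costs \<open>|A \<triangle> U|\<close> twice, once for \<open>A\<close> and once for
  its translate, and \<open>U\<close> itself moves by at most \<open>2|h| Per(U)\<close>.\<close>

lemma shift_diff_le_penalty:
  fixes A U :: "(real ^ 'n::finite) set"
  assumes A: "A \<in> sets lebesgue" and U: "open U" and h: "norm h \<le> t"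
  shows "emeasure lebesgue (sym_diff ((\<lambda>x. x + h) ` A) A)
    \<le> 2 * (emeasure lebesgue (sym_diff A U) + ennreal t * perimeter U)"
proof -
  let ?T = "\<lambda>X. (\<lambda>x. x + h) ` X"
  have [measurable]: "U \<in> sets borel" using U by simp
  have L: "U \<in> sets lebesgue" by simp
  have TL: "?T X \<in> sets lebesgue" if "X \<in> sets lebesgue" for X
    using lebesgue_sets_translation[OF that, of h] by (simp add: add.commute)
  have AU: "sym_diff A U \<in> sets lebesgue" using A L by blast
  have UU: "sym_diff (?T U) U \<in> sets lebesgue" using TL[OF L] L by blast
  have inj: "?T (sym_diff A U) = sym_diff (?T A) (?T U)"
    by (auto simp: image_iff)
  have "sym_diff (?T A) A \<subseteq> ?T (sym_diff A U) \<union> sym_diff (?T U) U \<union> sym_diff A U"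
    unfolding inj by blast
  then have "emeasure lebesgue (sym_diff (?T A) A)
      \<le> emeasure lebesgue (?T (sym_diff A U) \<union> sym_diff (?T U) U \<union> sym_diff A U)"
    by (rule emeasure_mono) (use TL[OF AU] UU AU in blast)
  also have "\<dots> \<le> emeasure lebesgue (?T (sym_diff A U) \<union> sym_diff (?T U) U) + emeasure lebesgue (sym_diff A U)"
    by (rule emeasure_subadditive) (use TL[OF AU] UU AU in blast)+
  also have "emeasure lebesgue (?T (sym_diff A U) \<union> sym_diff (?T U) U)
      \<le> emeasure lebesgue (?T (sym_diff A U)) + emeasure lebesgue (sym_diff (?T U) U)"
    by (rule emeasure_subadditive[OF TL[OF AU] UU])
  also have "emeasure lebesgue (?T (sym_diff A U)) = emeasure lebesgue (sym_diff A U)"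
    by (rule emeasure_lebesgue_translate)
  also have "emeasure lebesgue (sym_diff (?T U) U) \<le> 2 * (ennreal t * perimeter U)"
  proof -
    have "emeasure lebesgue (sym_diff (?T U) U) = emeasure lborel (shift_diff U (- h))"
      unfolding sym_diff_translate_eq_shift_diff by simp
    also have "\<dots> \<le> 2 * (ennreal (norm h) * perimeter U)"
      by (rule shift_diff_le_perimeter) simp
    also have "\<dots> \<le> 2 * (ennreal t * perimeter U)"
      using h by (intro mult_left_mono mult_right_mono ennreal_leI) auto
    finally show ?thesis .
  qed
  finally show ?thesis by (simp add: mult_2 distrib_left add_ac add_mono)
qed

text \<open>Fubini is applied on the product of Borel measures, where preimages of Lebesgue measurable sets
  under \<open>(x, y) \<mapsto> x + y\<close> need not be measurable. All quantities of the theorem are insensitive to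
  null sets, so \<open>A\<close> may be replaced by a Borel set.\<close>

lemma borel_representative:
  fixes A :: "'a::euclidean_space set"
  assumes "A \<in> sets lebesgue"
  obtains A' N where "A' \<in> sets borel" "N \<in> null_sets lborel" "sym_diff A A' \<subseteq> N"
proof -
  obtain S N N' where "A = S \<union> N" "N \<subseteq> N'" "N' \<in> null_sets lborel" "S \<in> sets lborel"
    using sets_completionE[OF assms] by metis
  then show ?thesis by (intro that[of S N']) auto
qed

lemma emeasure_lebesgue_cong_null:
  assumes "X \<in> sets lebesgue" "Y \<in> sets lebesgue" "N \<in> null_sets lborel" "sym_diff X Y \<subseteq> N"
  shows "emeasure lebesgue X = emeasure lebesgue Y"
proof (rule emeasure_eq_AE)
  have "N \<in> null_sets lebesgue" using assms(3) by (rule null_sets_completionI)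
  then show "AE x in lebesgue. x \<in> X \<longleftrightarrow> x \<in> Y"
    by (rule AE_I') (use assms(4) in auto)
qed (use assms in auto)

lemma penalty_K_cong_null:
  fixes A A' :: "(real ^ 'n::finite) set"
  assumes "A \<in> sets lebesgue" "A' \<in> sets lebesgue" "N \<in> null_sets lborel" "sym_diff A A' \<subseteq> N"
  shows "penalty_K t A = penalty_K t A'"
  unfolding penalty_K_def
proof (rule INF_cong)
  fix U :: "(real ^ 'n) set" assume "U \<in> {U. open U \<and> finite_perimeter U}"
  then have "U \<in> sets lebesgue" by simp
  then have "emeasure lebesgue (sym_diff A U) = emeasure lebesgue (sym_diff A' U)"
    using assms by (intro emeasure_lebesgue_cong_null[of _ _ N]) auto
  then show "emeasure lebesgue (sym_diff A U) + ennreal t * perimeter U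
      = emeasure lebesgue (sym_diff A' U) + ennreal t * perimeter U" by simp
qed simp

lemma emeasure_sym_diff_translate_cong_null:
  fixes A A' :: "'a::euclidean_space set"
  assumes A: "A \<in> sets lebesgue" "A' \<in> sets lebesgue"
    and N: "N \<in> null_sets lborel" "sym_diff A A' \<subseteq> N"
  shows "emeasure lebesgue (sym_diff ((\<lambda>x. x + h) ` A) A)
    = emeasure lebesgue (sym_diff ((\<lambda>x. x + h) ` A') A')"
proof (rule emeasure_lebesgue_cong_null)
  have "(\<lambda>x. x + h) ` X \<in> sets lebesgue" if "X \<in> sets lebesgue" for X
    using lebesgue_sets_translation[OF that, of h] by (simp add: add.commute)
  then show "sym_diff ((\<lambda>x. x + h) ` A) A \<in> sets lebesgue" "sym_diff ((\<lambda>x. x + h) ` A') A' \<in> sets lebesgue"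
    using A by blast+
  show "{x. x - h \<in> N} \<union> N \<in> null_sets lborel"
    by (rule null_sets.Un[OF null_sets_translation[OF N(1)] N(1)])
  show "sym_diff (sym_diff ((\<lambda>x. x + h) ` A) A) (sym_diff ((\<lambda>x. x + h) ` A') A') \<subseteq> {x. x - h \<in> N} \<union> N"
    unfolding sym_diff_translate_eq_shift_diff shift_diff_def using N(2) by auto
qed

theorem theorem4:
  shows "\<exists>c C :: real. c > 0 \<and> C > 0 \<and>
    (\<forall>A \<in> sets (lebesgue :: (real ^ 'n::finite) measure). \<forall>t :: real. t > 0 \<longrightarrow>
      ennreal c * (SUP h \<in> ball 0 t. emeasure lebesgue (sym_diff ((\<lambda>x. x + h) ` A) A))
        \<le> penalty_K t A \<and>
      penalty_K t A
        \<le> ennreal C * (SUP h \<in> ball 0 t. emeasure lebesgue (sym_diff ((\<lambda>x. x + h) ` A) A)))"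
proof (intro exI conjI ballI allI impI)
  show "(1 / 2 :: real) > 0" by simp
  show "4 + real CARD('n) * 2 ^ (CARD('n) + 3) > 0" by (simp add: add_pos_nonneg)
next
  fix A :: "(real ^ 'n) set" and t :: real
  assume A: "A \<in> sets lebesgue" and t: "t > 0"
  let ?S = "SUP h \<in> ball 0 t. emeasure lebesgue (sym_diff ((\<lambda>x. x + h) ` A) A)"
  have half: "ennreal (1 / 2) * (2 * x) = x" for x
  proof -
    have "ennreal (1 / 2) * ennreal 2 = 1" by (subst ennreal_mult[symmetric]) auto
    then show ?thesis by (simp add: mult.assoc[symmetric])
  qed
  show "ennreal (1 / 2) * ?S \<le> penalty_K t A"
    unfolding penalty_K_def
  proof (rule INF_greatest)
    fix U :: "(real ^ 'n) set" assume "U \<in> {U. open U \<and> finite_perimeter U}"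
    then have "?S \<le> 2 * (emeasure lebesgue (sym_diff A U) + ennreal t * perimeter U)"
      using A by (intro SUP_least shift_diff_le_penalty) auto
    then have "ennreal (1 / 2) * ?S
        \<le> ennreal (1 / 2) * (2 * (emeasure lebesgue (sym_diff A U) + ennreal t * perimeter U))"
      by (rule mult_left_mono) simp
    then show "ennreal (1 / 2) * ?S \<le> emeasure lebesgue (sym_diff A U) + ennreal t * perimeter U"
      unfolding half .
  qed
  obtain A' N where A': "A' \<in> sets borel" "N \<in> null_sets lborel" "sym_diff A A' \<subseteq> N"
    using borel_representative[OF A] .
  have A'L: "A' \<in> sets lebesgue" using A'(1) by simp
  have "penalty_K t A' \<le> ennreal (4 + real CARD('n) * 2 ^ (CARD('n) + 3)) * ?S"
  proof (rule penalty_K_le_shift_diff[OF A'(1) t])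
    fix y :: "real ^ 'n" assume y: "y \<in> ball 0 t"
    have "emeasure lborel (shift_diff A' y) = emeasure lebesgue (sym_diff ((\<lambda>x. x + (- y)) ` A') A')"
      unfolding sym_diff_translate_eq_shift_diff using A'(1) by simp
    also have "\<dots> = emeasure lebesgue (sym_diff ((\<lambda>x. x + (- y)) ` A) A)"
      by (rule emeasure_sym_diff_translate_cong_null[OF A A'L A'(2,3), symmetric])
    also have "\<dots> \<le> ?S" using y by (intro SUP_upper) simp
    finally show "emeasure lborel (shift_diff A' y) \<le> ?S" .
  qed
  then show "penalty_K t A \<le> ennreal (4 + real CARD('n) * 2 ^ (CARD('n) + 3)) * ?S"
    unfolding penalty_K_cong_null[OF A A'L A'(2,3)] .
qed

end
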